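(* Fix a tuple $\mu=(\mu_1,\ldots,\mu_n)$ of positive integers with sum $d=\mu_1+\cdots+\mu_n\geq 2$. Then there exist integers $C(\mu,m)\in\mathbb{Z}$, for $1\le m\le\binom{d}{2}$, such that for all non-negative integers $g$, \[ H_{g;\mu} = \frac{2}{d!\,\mu_1\cdots\mu_n}\sum_{1\le m\le \binom{d}{2}} C(\mu,m)\, m^{d+2g-2+n}. \]
   Context: For an integer $g$ and a tuple $\mu=(\mu_1,\ldots,\mu_n)$ of positive integers, the Hurwitz number $H_{g;\mu}$ is the weighted count of genus $g$ connected branched covers $f:\Sigma\to\mathbb{CP}^1$ with ramification profile $\mu$ over $\infty$, simple ramification over $|\mu|+2g-2+n$ fixed prescribed points of $\mathbb{CP}^1$, and no other branching; the preimages of $\infty$ are labelled $1,\ldots,n$ so that the point labelled $i$ has ramification index $\mu_i$. Isomorphisms are Riemann surface isomorphisms $\phi$ with $f=\tilde f\circ\phi$ preserving these labels, and each cover is counted with weight $1/|\mathrm{Aut}|$. Equivalently, $H_{g;\mu}$ equals $\frac{|\mathrm{Aut}(\mu)|}{|\mu|!}$ times the number of tuples $(\tau_1,\ldots,\tau_{|\mu|+2g-2+n})$ of transpositions in $S_{|\mu|}$ generating a transitive subgroup whose product has cycle type $\mu$, where $\mathrm{Aut}(\mu)$ is the group of permutations of the entries of the tuple $\mu$ fixing it. *)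

theory Defs
  imports
    Complex_Main
    "HOL-Library.Multiset"
    "HOL-Combinatorics.Permutations"
    "HOL-Combinatorics.Orbits"
    "HOL-Algebra.Sym_Groups"
begin

text \<open>
  The symmetric group on \<open>d\<close> letters is \<^const>\<open>sym_group\<close>, acting on \<open>{1..d}\<close>;
  a tuple \<open>\<mu>\<close> of positive integers is a list.
\<close>

definition transpositions :: "nat \<Rightarrow> (nat \<Rightarrow> nat) set" where
  "transpositions d = {transpose a b | a b. a \<in> {1..d} \<and> b \<in> {1..d} \<and> a \<noteq> b}"

text \<open>Fixed points contribute parts equal to 1, so this is a partition of \<open>d\<close>.\<close>

definition cycle_type :: "nat \<Rightarrow> (nat \<Rightarrow> nat) \<Rightarrow> nat multiset" where
  "cycle_type d p = image_mset card (mset_set ((\<lambda>x. Orbits.orbit p x) ` {1..d}))"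

definition transitive_on :: "nat \<Rightarrow> (nat \<Rightarrow> nat) set \<Rightarrow> bool" where
  "transitive_on d H \<longleftrightarrow> (\<forall>x\<in>{1..d}. \<forall>y\<in>{1..d}. \<exists>p\<in>H. p x = y)"

definition tuple_aut :: "nat list \<Rightarrow> (nat \<Rightarrow> nat) set" where
  "tuple_aut \<mu> = {\<sigma>. \<sigma> permutes {..<length \<mu>} \<and> permute_list \<sigma> \<mu> = \<mu>}"

text \<open>
  Monodromy data of the connected genus \<open>g\<close> covers with profile \<open>\<mu>\<close> over infinity.
  The Riemann--Hurwitz condition on the number of transpositions is stated over the
  integers, so that no truncated subtraction is involved and there are no such tuples
  when the required number is negative.
\<close>

definition hurwitz_tuples :: "int \<Rightarrow> nat list \<Rightarrow> (nat \<Rightarrow> nat) list set" where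
  "hurwitz_tuples g \<mu> = {\<tau>s.
     int (length \<tau>s) = int (sum_list \<mu>) + 2 * g - 2 + int (length \<mu>) \<and>
     set \<tau>s \<subseteq> transpositions (sum_list \<mu>) \<and>
     transitive_on (sum_list \<mu>) (generate (sym_group (sum_list \<mu>)) (set \<tau>s)) \<and>
     cycle_type (sum_list \<mu>) (foldr (\<circ>) \<tau>s id) = mset \<mu>}"

text \<open>
  The count of covers weighted by \<open>1 / |Aut|\<close>, in its monodromy form: dividing by \<open>d!\<close>
  accounts for the labelling of a generic fibre, and the factor \<open>|Aut(\<mu>)|\<close> for the
  labelling of the preimages of infinity.
\<close>

definition hurwitz_number :: "int \<Rightarrow> nat list \<Rightarrow> real" where
  "hurwitz_number g \<mu> =
     real (card (tuple_aut \<mu>)) / fact (sum_list \<mu>) * real (card (hurwitz_tuples g \<mu>))"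

end

theory Submission
  imports Defs
begin

text \<open>
  Fix \<open>\<sigma>\<close> of cycle type \<open>\<mu>\<close>. Conjugation reduces the Hurwitz number to the number \<open>N(r)\<close> of transitive
  factorizations of \<open>\<sigma>\<close> into \<open>r\<close> transpositions, divided by \<open>\<mu>\<^sub>1 \<cdots> \<mu>\<^sub>n\<close>. Sorting factorizations by
  the orbits of the group they generate expresses \<open>N\<close> as an integer combination of the numbers of
  factorizations into transpositions inside the classes of an equivalence relation preserved
  by \<open>\<sigma>\<close>. Multiplied by \<open>d!\<close>, such a number is the trace of \<open>P T\<^sup>r\<close> on \<open>\<int>[S\<^sub>d]\<close>, where \<open>T\<close> is
  multiplication by the sum of these transpositions and \<open>P\<close> is multiplication by \<open>\<sigma>\<inverse>\<close>, which commutes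
  with \<open>T\<close>. As a sum of commuting Jucys--Murphy elements \<open>T\<close> has integer eigenvalues, of absolute
  value at most \<open>d choose 2\<close>, and being symmetric it is diagonalizable; so the trace is
  \<open>\<Sum> a\<^sub>m m\<^sup>r\<close> with \<open>a\<^sub>m\<close> the trace of \<open>P\<close> on the eigenlattice of \<open>m\<close>, an integer. Finally \<open>N(r)\<close>
  vanishes for all \<open>r\<close> of the wrong parity, which forces \<open>a\<^sub>-\<^sub>m = \<plusminus>a\<^sub>m\<close> and yields the factor \<open>2\<close>.
\<close>

section \<open>Integral operators annihilated by integer shifts\<close>

definition linear_op :: "(('a \<Rightarrow> int) \<Rightarrow> ('b \<Rightarrow> int)) \<Rightarrow> bool" where
  "linear_op T \<longleftrightarrow> (\<forall>c e u v. T (\<lambda>p. c * u p + e * v p) = (\<lambda>p. c * T u p + e * T v p))"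

lemma linear_opI:
  assumes "\<And>c e u v p. T (\<lambda>p. c * u p + e * v p) p = c * T u p + e * T v p"
  shows "linear_op T"
  using assms by (simp add: linear_op_def fun_eq_iff)

lemma linear_op_combination:
  "linear_op T \<Longrightarrow> T (\<lambda>p. c * u p + e * v p) = (\<lambda>p. c * T u p + e * T v p)"
  by (simp add: linear_op_def)

lemma linear_op_scale: "linear_op T \<Longrightarrow> T (\<lambda>p. c * u p) = (\<lambda>p. c * T u p)"
  using linear_op_combination[of T c u 0 u] by simp

lemma linear_op_zero: "linear_op T \<Longrightarrow> T (\<lambda>p. 0) = (\<lambda>p. 0)"
  using linear_op_scale[of T 0] by simp

lemma linear_op_add: "linear_op T \<Longrightarrow> T (\<lambda>p. u p + v p) = (\<lambda>p. T u p + T v p)"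
  using linear_op_combination[of T 1 u 1 v] by simp

lemma linear_op_diff: "linear_op T \<Longrightarrow> T (\<lambda>p. u p - v p) = (\<lambda>p. T u p - T v p)"
  using linear_op_combination[of T 1 u "-1" v] by simp

lemma linear_op_sum:
  assumes "linear_op T"
  shows "T (\<lambda>p. \<Sum>i\<in>I. c i * u i p) = (\<lambda>p. \<Sum>i\<in>I. c i * T (u i) p)"
proof (induction I rule: infinite_finite_induct)
  case (insert x F)
  have "T (\<lambda>p. \<Sum>i\<in>insert x F. c i * u i p) = T (\<lambda>p. c x * u x p + 1 * (\<Sum>i\<in>F. c i * u i p))"
    using insert by simp
  also have "\<dots> = (\<lambda>p. \<Sum>i\<in>insert x F. c i * T (u i) p)"
    using insert by (subst linear_op_combination[OF assms]) simp
  finally show ?case .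
qed (simp_all add: linear_op_zero[OF assms])

lemma linear_op_funpow:
  fixes T :: "('a \<Rightarrow> int) \<Rightarrow> ('a \<Rightarrow> int)"
  assumes "linear_op T"
  shows "linear_op (T ^^ r)"
proof (induction r)
  case (Suc r)
  then show ?case
    using assms by (auto simp: linear_op_def)
qed (simp add: linear_op_def)

section \<open>Products of integer shifts of an operator\<close>

definition shift :: "(('a \<Rightarrow> int) \<Rightarrow> ('a \<Rightarrow> int)) \<Rightarrow> int \<Rightarrow> ('a \<Rightarrow> int) \<Rightarrow> ('a \<Rightarrow> int)" where
  "shift T m v = (\<lambda>p. T v p - m * v p)"

text \<open>This is \<open>p(T) v\<close> for the monic polynomial \<open>p\<close> whose roots,
  with multiplicity, are the entries of the list; for linear \<open>T\<close> the order of the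
  factors is immaterial by \<open>shift_shifts\<close>.\<close>

fun shifts :: "(('a \<Rightarrow> int) \<Rightarrow> ('a \<Rightarrow> int)) \<Rightarrow> int list \<Rightarrow> ('a \<Rightarrow> int) \<Rightarrow> ('a \<Rightarrow> int)" where
  "shifts T [] v = v"
| "shifts T (m # ms) v = shifts T ms (shift T m v)"

lemma shifts_append: "shifts T (ms @ ns) v = shifts T ns (shifts T ms v)"
  by (induction ms arbitrary: v) auto

lemma linear_op_shift: "linear_op T \<Longrightarrow> linear_op (shift T m)"
  by (auto intro!: linear_opI simp: shift_def linear_op_combination algebra_simps)

lemma linear_op_shifts: "linear_op T \<Longrightarrow> linear_op (shifts T ms)"
proof (induction ms)
  case (Cons m ms)
  then show ?case
    by (auto intro!: linear_opI simp: linear_op_combination[OF linear_op_shift] linear_op_combination)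
qed (simp add: linear_op_def)

lemma op_shift_commute:
  assumes "linear_op X" "\<And>v. X (T v) = T (X v)"
  shows "X (shift T m v) = shift T m (X v)"
  using linear_op_combination[OF assms(1), of 1 "T v" "-m" v] assms(2) by (simp add: shift_def)

lemma op_shifts_commute:
  assumes "linear_op X" "\<And>v. X (T v) = T (X v)"
  shows "X (shifts T ms v) = shifts T ms (X v)"
  by (induction ms arbitrary: v) (simp_all add: op_shift_commute[of X T, OF assms])

lemma shift_commute:
  assumes "linear_op X" "linear_op T" "\<And>v. X (T v) = T (X v)"
  shows "shift X k (shift T m v) = shift T m (shift X k v)"
  using op_shift_commute[of "shift X k" T] op_shift_commute[of T X] assms
  by (simp add: linear_op_shift)

lemma shift_shifts:
  assumes "linear_op T"
  shows "shift T m (shifts T ms v) = shifts T ms (shift T m v)"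
  using op_shifts_commute[of "shift T m" T] op_shift_commute[of T T] assms
  by (simp add: linear_op_shift)

lemma shifts_swap:
  assumes "linear_op T"
  shows "shifts T (xs @ m # ys) v = shift T m (shifts T (xs @ ys) v)"
  using assms by (simp add: shifts_append shift_shifts)

section \<open>Operators with integer spectrum: commuting sums and the Hecke step\<close>

text \<open>Only an annihilating polynomial with integer roots is required, and roots may repeat.
  Squarefreeness is obtained separately, from symmetry, in
  \<open>integer_spectrum_squarefree\<close>.\<close>

definition integer_spectrum :: "(('a \<Rightarrow> int) \<Rightarrow> ('a \<Rightarrow> int)) \<Rightarrow> bool" where
  "integer_spectrum T \<longleftrightarrow> (\<exists>ms. \<forall>v. shifts T ms v = (\<lambda>_. 0))"

text \<open>If \<open>X - a\<close> is one factor of a product annihilating \<open>v\<close>, the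
  other factors send \<open>v\<close> into the kernel of \<open>X - a\<close>, which
  \<open>q a\<close> evaluated at \<open>Z\<close> annihilates. Commutation moves this polynomial in
  \<open>Z\<close> onto \<open>v\<close> and leaves a shorter product in \<open>X\<close>. The
  polynomial may depend on \<open>a\<close>, but not on the vector.\<close>

lemma integer_spectrum_by_eigenspaces:
  assumes X: "linear_op X" and Z: "linear_op Z" and com: "\<And>v. X (Z v) = Z (X v)"
    and spec: "integer_spectrum X"
    and eig: "\<And>a. \<exists>q. \<forall>v. shift X a v = (\<lambda>_. 0) \<longrightarrow> shifts Z q v = (\<lambda>_. 0)"
  shows "integer_spectrum Z"
proof -
  obtain ms where ms: "\<And>v. shifts X ms v = (\<lambda>_. 0)"
    using spec by (auto simp: integer_spectrum_def)
  obtain q where q: "\<And>a v. shift X a v = (\<lambda>_. 0) \<Longrightarrow> shifts Z (q a) v = (\<lambda>_. 0)"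
    using eig by metis
  have "shifts X ms v = (\<lambda>_. 0) \<Longrightarrow> shifts Z (concat (map q ms)) v = (\<lambda>_. 0)" for v ms
  proof (induction ms arbitrary: v)
    case (Cons a ms)
    have "shift X a (shifts X ms v) = (\<lambda>_. 0)"
      using Cons.prems by (simp add: shift_shifts[OF X])
    then have "shifts Z (q a) (shifts X ms v) = (\<lambda>_. 0)"
      by (rule q)
    then have "shifts X ms (shifts Z (q a) v) = (\<lambda>_. 0)"
      using op_shifts_commute[of "shifts X ms" Z] op_shifts_commute[of Z X] com X Z
      by (simp add: linear_op_shifts)
    then show ?case
      using Cons.IH by (simp add: shifts_append)
  qed simp
  then show ?thesis
    using ms by (auto simp: integer_spectrum_def)
qed

text \<open>On the kernel of \<open>X - a\<close> the sum acts as \<open>a + Y\<close>, so the roots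
  belonging to \<open>Y\<close>, translated by \<open>a\<close>, serve there.\<close>

lemma integer_spectrum_add:
  assumes X: "linear_op X" and Y: "linear_op Y" and com: "\<And>v. X (Y v) = Y (X v)"
    and "integer_spectrum X" and specY: "integer_spectrum Y"
  shows "integer_spectrum (\<lambda>v p. X v p + Y v p)"
proof (rule integer_spectrum_by_eigenspaces[OF X])
  show "linear_op (\<lambda>v p. X v p + Y v p)"
    using X Y by (auto intro!: linear_opI simp: linear_op_combination algebra_simps)
  show "X (\<lambda>p. X v p + Y v p) = (\<lambda>p. X (X v) p + Y (X v) p)" for v
    by (simp add: linear_op_add[OF X] com)
  obtain ns where ns: "\<And>v. shifts Y ns v = (\<lambda>_. 0)"
    using specY by (auto simp: integer_spectrum_def)
  show "\<exists>q. \<forall>v. shift X a v = (\<lambda>_. 0) \<longrightarrow> shifts (\<lambda>v p. X v p + Y v p) q v = (\<lambda>_. 0)" for a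
  proof (intro exI allI impI)
    fix v
    have "shift X a v = (\<lambda>_. 0) \<Longrightarrow> shifts (\<lambda>v p. X v p + Y v p) (map ((+) a) ns) v = shifts Y ns v"
      for ns v
    proof (induction ns arbitrary: v)
      case (Cons k ns)
      have "shift (\<lambda>v p. X v p + Y v p) (a + k) v = shift Y k v"
        using Cons.prems by (auto simp: shift_def fun_eq_iff algebra_simps)
      moreover have "shift X a (shift Y k v) = (\<lambda>_. 0)"
        by (simp add: shift_commute[of X Y, OF X Y com] Cons.prems linear_op_zero[OF linear_op_shift[OF Y]])
      ultimately show ?case
        using Cons.IH by simp
    qed simp
    then show "shift X a v = (\<lambda>_. 0) \<Longrightarrow> shifts (\<lambda>v p. X v p + Y v p) (map ((+) a) ns) v = (\<lambda>_. 0)"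
      using ns by simp
  qed
qed fact

text \<open>
  The relations are those of the degenerate affine Hecke algebra. If \<open>p(J) = 0\<close>, then on \<open>ker (J - a)\<close>
  the operator \<open>U = s(L - a) - 1\<close> satisfies \<open>J U = U L\<close>, so \<open>U p(L) = 0\<close> there, which gives
  \<open>((L - a)\<^sup>2 - 1) p(L) = 0\<close>.
\<close>

lemma integer_spectrum_hecke_step:
  assumes J: "linear_op J" and L: "linear_op L" and s: "linear_op s"
    and com: "\<And>v. J (L v) = L (J v)"
    and ss: "\<And>v. s (s v) = v"
    and sL: "\<And>v. s (L v) = (\<lambda>p. J (s v) p + v p)"
    and Ls: "\<And>v. L (s v) = (\<lambda>p. s (J v) p + v p)"
    and spec: "integer_spectrum J"
  shows "integer_spectrum L"
proof (rule integer_spectrum_by_eigenspaces[OF J L com spec])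
  fix a
  obtain ms where ms: "\<And>v. shifts J ms v = (\<lambda>_. 0)"
    using spec by (auto simp: integer_spectrum_def)
  define U where "U w = (\<lambda>p. s (shift L a w) p - w p)" for w
  have ker_shift: "shift J a (shift L m w) = (\<lambda>_. 0)" if "shift J a w = (\<lambda>_. 0)" for w m
    by (simp add: shift_commute[of J L, OF J L com] that linear_op_zero[OF linear_op_shift[OF L]])
  have U1: "shift J m (U w) = U (shift L m w)" if w: "shift J a w = (\<lambda>_. 0)" for m w
  proof -
    have Jw: "J w = (\<lambda>p. a * w p)"
      using w by (simp add: shift_def fun_eq_iff)
    \<comment> \<open>By \<open>sL\<close>, \<open>J s = s L - 1\<close>. The two corrections
      \<open>-(L - a) w\<close> and \<open>-J w = -a w\<close> add up to \<open>-L w\<close>, the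
      last term of \<open>U (L w)\<close>.\<close>
    have "J (U w) = (\<lambda>p. J (s (shift L a w)) p - J w p)"
      by (simp add: U_def linear_op_diff[OF J])
    also have "J (s (shift L a w)) = (\<lambda>p. s (L (shift L a w)) p - shift L a w p)"
      by (simp add: sL)
    also have "L (shift L a w) = shift L a (L w)"
      by (rule op_shift_commute[OF L]) simp
    finally have JU: "J (U w) = U (L w)"
      by (auto simp: U_def Jw shift_def fun_eq_iff)
    have "linear_op U"
      by (rule linear_opI) (simp add: U_def linear_op_combination[OF linear_op_shift[OF L]]
          linear_op_combination[OF s] algebra_simps)
    then have "U (shift L m w) = (\<lambda>p. U (L w) p - m * U w p)"
      using linear_op_combination[of U 1 "L w" "-m" w] by (simp add: shift_def)
    then show ?thesis
      by (simp add: shift_def JU)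
  qed
  have U: "shifts J ks (U w) = U (shifts L ks w) \<and> shift J a (shifts L ks w) = (\<lambda>_. 0)"
    if "shift J a w = (\<lambda>_. 0)" for ks w
    using that by (induction ks arbitrary: w) (simp_all add: U1 ker_shift)
  show "\<exists>q. \<forall>v. shift J a v = (\<lambda>_. 0) \<longrightarrow> shifts L q v = (\<lambda>_. 0)"
  proof (intro exI allI impI)
    fix v assume v: "shift J a v = (\<lambda>_. 0)"
    define w where "w = shifts L ms v"
    have "U w = (\<lambda>_. 0)" and Jw: "J w = (\<lambda>p. a * w p)"
      using U[OF v, of ms] ms[of "U v"] by (simp_all add: w_def shift_def fun_eq_iff)
    then have "s (shift L a w) = w"
      by (simp add: U_def fun_eq_iff)
    then have sw: "shift L a w = s w"
      by (metis ss)
    \<comment> \<open>\<open>L - a\<close> exchanges \<open>w\<close> and \<open>s w\<close>: it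
      sends \<open>w\<close> to \<open>s w\<close> by \<open>sw\<close>, and \<open>s w\<close> back
      to \<open>w\<close> by this relation. Hence \<open>w\<close> is killed by
      \<open>(L - a)^2 - 1\<close>, whose roots are \<open>a + 1\<close> and
      \<open>a - 1\<close>.\<close>
    have "L (s w) = (\<lambda>p. a * s w p + w p)"
      by (simp add: Ls Jw linear_op_scale[OF s])
    then have "shift L (a - 1) (shift L (a + 1) w) = (\<lambda>_. 0)"
      using sw by (simp add: shift_def linear_op_diff[OF L] linear_op_scale[OF L] fun_eq_iff
          algebra_simps)
    then show "shifts L (ms @ [a + 1, a - 1]) v = (\<lambda>_. 0)"
      by (simp add: shifts_append w_def)
  qed
qed

section \<open>Integrality of traces on eigenspaces\<close>

text \<open>For finite \<open>X\<close> this is the free abelian group on \<open>X\<close>, realised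
  inside the functions on the whole type.\<close>

definition supported_on :: "'a set \<Rightarrow> ('a \<Rightarrow> int) set" where
  "supported_on X = {v. \<forall>p. p \<notin> X \<longrightarrow> v p = 0}"

lemma linear_op_shift_sum:
  assumes "linear_op T"
  shows "shift T k (\<lambda>p. \<Sum>i\<in>I. c i * u i p) = (\<lambda>p. \<Sum>i\<in>I. c i * shift T k (u i) p)"
  by (rule linear_op_sum[OF linear_op_shift[OF assms]])

text \<open>Eigenprojections need not be integral, so \<open>W m\<close> is the projection to the
  \<open>m\<close>-eigenspace multiplied by a common denominator \<open>D\<close>. The induction on
  the roots is Lagrange interpolation.\<close>

lemma eigenspace_decomposition:
  fixes T :: "('a \<Rightarrow> int) \<Rightarrow> ('a \<Rightarrow> int)"
  assumes T: "linear_op T" and inv: "\<And>v. v \<in> supported_on X \<Longrightarrow> T v \<in> supported_on X"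
    and "distinct ms"
  shows "\<exists>D W. D \<noteq> 0 \<and> (\<forall>m\<in>set ms. linear_op (W m) \<and> (\<forall>v\<in>supported_on X. W m v \<in> supported_on X) \<and>
        (\<forall>v. shift T m v = (\<lambda>_. 0) \<longrightarrow> W m v = (\<lambda>p. D * v p))) \<and>
      (\<forall>v. shifts T ms v = (\<lambda>_. 0) \<longrightarrow> (\<forall>m\<in>set ms. shift T m (W m v) = (\<lambda>_. 0)) \<and>
        (\<forall>p. (\<Sum>m\<in>set ms. W m v p) = D * v p))"
  using \<open>distinct ms\<close>
proof (induction ms)
  case Nil
  show ?case
    by (rule exI[of _ 1]) auto
next
  case (Cons k ms)
  then have "distinct ms"
    by simp
  from Cons.IH[OF this] obtain D W where D: "D \<noteq> 0"
    and W1: "\<forall>m\<in>set ms. linear_op (W m) \<and> (\<forall>v\<in>supported_on X. W m v \<in> supported_on X) \<and>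
        (\<forall>v. shift T m v = (\<lambda>_. 0) \<longrightarrow> W m v = (\<lambda>p. D * v p))"
    and W2: "\<forall>v. shifts T ms v = (\<lambda>_. 0) \<longrightarrow> (\<forall>m\<in>set ms. shift T m (W m v) = (\<lambda>_. 0)) \<and>
        (\<forall>p. (\<Sum>m\<in>set ms. W m v p) = D * v p)"
    by blast
  have W: "\<And>m. m \<in> set ms \<Longrightarrow> linear_op (W m)"
      "\<And>m v. m \<in> set ms \<Longrightarrow> v \<in> supported_on X \<Longrightarrow> W m v \<in> supported_on X"
      "\<And>m v. m \<in> set ms \<Longrightarrow> shift T m v = (\<lambda>_. 0) \<Longrightarrow> W m v = (\<lambda>p. D * v p)"
      "\<And>m v. m \<in> set ms \<Longrightarrow> shifts T ms v = (\<lambda>_. 0) \<Longrightarrow> shift T m (W m v) = (\<lambda>_. 0)"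
      "\<And>v p. shifts T ms v = (\<lambda>_. 0) \<Longrightarrow> (\<Sum>m\<in>set ms. W m v p) = D * v p"
    using W1 W2 by blast+
  have k: "k \<notin> set ms"
    using Cons.prems by simp
  \<comment> \<open>For an old root \<open>m\<close>, \<open>W m\<close> is applied after
    \<open>T - k\<close>, which sends \<open>v\<close> to a vector killed by the old shifts. Since
    \<open>T - k\<close> acts as \<open>m - k\<close> on the \<open>m\<close>-eigenspace, the factor
    \<open>F m = E / (m - k)\<close> brings all components to the denominator
    \<open>D * E\<close>.\<close>
  define E where "E = (\<Prod>m\<in>set ms. m - k)"
  define F where "F m = E div (m - k)" for m
  have E: "E \<noteq> 0"
    using k by (auto simp: E_def)
  have F: "F m * (m - k) = E" if "m \<in> set ms" for m
    unfolding F_def E_def by (rule dvd_div_mult_self) (use that in \<open>auto intro: dvd_prodI\<close>)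
  define W0 where "W0 m v = (\<lambda>p. F m * W m (shift T k v) p)" for m v
  \<comment> \<open>The component at the new root \<open>k\<close> is what the other components
    leave over.\<close>
  define W1 where "W1 v = (\<lambda>p. D * E * v p - (\<Sum>m\<in>set ms. W0 m v p))" for v
  define W' where "W' = (\<lambda>m. if m = k then W1 else W0 m)"
  have W0_lin: "linear_op (W0 m)" if "m \<in> set ms" for m
    by (rule linear_opI) (simp add: W0_def linear_op_combination[OF linear_op_shift[OF T]]
        linear_op_combination[OF W(1)[OF that]] algebra_simps)
  have W1_lin: "linear_op W1"
    by (rule linear_opI) (simp add: W1_def linear_op_combination[OF W0_lin] sum.distrib
        sum_distrib_left right_diff_distrib algebra_simps)
  have shift_supp: "shift T k v \<in> supported_on X" if "v \<in> supported_on X" for v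
    using that inv[OF that] by (auto simp: shift_def supported_on_def)
  have W0_supp: "W0 m v \<in> supported_on X" if "m \<in> set ms" "v \<in> supported_on X" for m v
    using W(2)[OF that(1) shift_supp[OF that(2)]] by (auto simp: W0_def supported_on_def)
  have W1_supp: "W1 v \<in> supported_on X" if "v \<in> supported_on X" for v
    using that W0_supp[OF _ that] by (auto simp: W1_def supported_on_def)
  have W0_eig: "W0 m v = (\<lambda>p. D * E * v p)" if "m \<in> set ms" "shift T m v = (\<lambda>_. 0)" for m v
  proof -
    have "shift T k v = (\<lambda>p. (m - k) * v p)"
      using that(2) by (auto simp: shift_def fun_eq_iff algebra_simps)
    then show ?thesis
      using W(3)[OF that]
      by (simp add: W0_def linear_op_scale[OF W(1)[OF that(1)]] flip: F[OF that(1)])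
        (simp add: mult_ac)
  qed
  have W1_eig: "W1 v = (\<lambda>p. D * E * v p)" if "shift T k v = (\<lambda>_. 0)" for v
    using that by (simp add: W1_def W0_def linear_op_zero[OF W(1)])
  have W0_in: "shift T m (W0 m v) = (\<lambda>_. 0)"
    if "m \<in> set ms" "shifts T (k # ms) v = (\<lambda>_. 0)" for m v
    using W(4)[OF that(1), of "shift T k v"] that
    by (simp add: W0_def linear_op_scale[OF linear_op_shift[OF T]])
  have W1_in: "shift T k (W1 v) = (\<lambda>_. 0)" if v: "shifts T (k # ms) v = (\<lambda>_. 0)" for v
  proof -
    \<comment> \<open>\<open>W0 m v\<close> lies in the \<open>m\<close>-eigenspace, so
      \<open>T - k\<close> multiplies it by \<open>m - k\<close>, and this completes
      \<open>F m\<close> to \<open>E\<close>. Summation over \<open>m\<close> then reproduces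
      \<open>D * E\<close> times \<open>(T - k) v\<close>, which cancels.\<close>
    have *: "shift T k (W0 m v) = (\<lambda>p. E * W m (shift T k v) p)" if "m \<in> set ms" for m
      using W0_in[OF that v] by (auto simp: shift_def W0_def fun_eq_iff algebra_simps simp flip: F[OF that])
    have "shift T k (W1 v) = (\<lambda>p. D * E * shift T k v p - shift T k (\<lambda>p. \<Sum>m\<in>set ms. 1 * W0 m v p) p)"
      using linear_op_combination[OF linear_op_shift[OF T], of k "D * E" v "-1" "\<lambda>p. \<Sum>m\<in>set ms. W0 m v p"]
      by (simp add: W1_def)
    also have "\<dots> = (\<lambda>p. D * E * shift T k v p - (\<Sum>m\<in>set ms. E * W m (shift T k v) p))"
      by (subst linear_op_shift_sum[OF T]) (simp add: *)
    also have "\<dots> = (\<lambda>_. 0)"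
      using W(5)[of "shift T k v"] v by (simp flip: sum_distrib_left)
    finally show ?thesis .
  qed
  have W'_k: "W' k = W1" and W'_m: "\<And>m. m \<in> set ms \<Longrightarrow> W' m = W0 m"
    using k by (auto simp: W'_def)
  show ?case
    using D E k W0_lin W1_lin W0_supp W1_supp W0_eig W1_eig W0_in W1_in
    by (intro exI[of _ "D * E"] exI[of _ W']) (auto simp: W'_k W'_m W1_def)
qed

section \<open>Subgroups of finite-rank free abelian groups and their coordinates\<close>

definition int_submodule :: "('a \<Rightarrow> int) set \<Rightarrow> bool" where
  "int_submodule M \<longleftrightarrow> (\<lambda>_. 0) \<in> M \<and> (\<forall>c e. \<forall>u\<in>M. \<forall>v\<in>M. (\<lambda>p. c * u p + e * v p) \<in> M)"

lemma int_submodule_combination: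
  "int_submodule M \<Longrightarrow> u \<in> M \<Longrightarrow> v \<in> M \<Longrightarrow> (\<lambda>p. c * u p + e * v p) \<in> M"
  by (auto simp: int_submodule_def)

text \<open>Linearity is asked on \<open>M\<close> only: the coordinates constructed in
  \<open>dual_basis\<close> use \<open>div\<close>, which is additive where the division is
  exact.\<close>

definition functional_on :: "('a \<Rightarrow> int) set \<Rightarrow> (('a \<Rightarrow> int) \<Rightarrow> int) \<Rightarrow> bool" where
  "functional_on M f \<longleftrightarrow> (\<forall>c e. \<forall>u\<in>M. \<forall>v\<in>M. f (\<lambda>p. c * u p + e * v p) = c * f u + e * f v)"

lemma functional_on_sum:
  assumes M: "int_submodule M" and f: "functional_on M f" and u: "\<And>i. i \<in> I \<Longrightarrow> u i \<in> M"
    and fin: "finite I"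
  shows "f (\<lambda>p. \<Sum>i\<in>I. c i * u i p) = (\<Sum>i\<in>I. c i * f (u i)) \<and> (\<lambda>p. \<Sum>i\<in>I. c i * u i p) \<in> M"
  using fin u
proof (induction I rule: finite_induct)
  case empty
  have "(\<lambda>_. 0) \<in> M"
    using M by (simp add: int_submodule_def)
  then have "f (\<lambda>p. 0) = 0"
    using f[unfolded functional_on_def, rule_format, of "\<lambda>_. 0" "\<lambda>_. 0" 0 0] by simp
  then show ?case
    using M by (simp add: int_submodule_def)
next
  case (insert x F)
  then have "f (\<lambda>p. c x * u x p + 1 * (\<Sum>i\<in>F. c i * u i p)) =
      c x * f (u x) + 1 * f (\<lambda>p. \<Sum>i\<in>F. c i * u i p)"
    using f[unfolded functional_on_def, rule_format, of "u x" "\<lambda>p. \<Sum>i\<in>F. c i * u i p" "c x" 1] by simp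
  moreover have "(\<lambda>p. c x * u x p + 1 * (\<Sum>i\<in>F. c i * u i p)) \<in> M"
    using insert by (intro int_submodule_combination[OF M]) auto
  ultimately show ?case
    using insert by simp
qed

text \<open>Induction on the support. The values at \<open>x\<close> of members of \<open>M\<close>
  form an ideal; if it is nonzero, let \<open>w\<close> attain its least positive element
  \<open>g\<close>. Subtracting \<open>v x div g\<close> times \<open>w\<close> leaves a member of
  \<open>M\<close> vanishing at \<open>x\<close>, to which the induction hypothesis applies.\<close>

lemma dual_basis:
  assumes "finite X" "int_submodule M" "M \<subseteq> supported_on X"
  shows "\<exists>(n::nat) b f. (\<forall>i<n. b i \<in> M \<and> functional_on M (f i)) \<and>
    (\<forall>v\<in>M. v = (\<lambda>p. \<Sum>i<n. f i v * b i p))"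
  using assms
proof (induction X arbitrary: M rule: finite_induct)
  case empty
  then show ?case
    by (intro exI[of _ 0]) (auto simp: supported_on_def)
next
  case (insert x X)
  show ?case
  proof (cases "\<forall>v\<in>M. v x = 0")
    case True
    then have "M \<subseteq> supported_on X"
      using insert.prems(2) by (fastforce simp: supported_on_def)
    then show ?thesis
      using insert by blast
  next
    case False
    then obtain v0 where v0: "v0 \<in> M" "v0 x \<noteq> 0"
      by blast
    define Q where "Q g \<longleftrightarrow> 0 < g \<and> (\<exists>v\<in>M. v x = int g)" for g
    have "(\<lambda>p. sgn (v0 x) * v0 p + 0 * v0 p) \<in> M"
      by (rule int_submodule_combination[OF insert.prems(1) v0(1) v0(1)])
    then have "\<exists>v\<in>M. v x = \<bar>v0 x\<bar>"
      by (rule bexI[rotated]) (simp add: abs_sgn mult.commute)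
    then have "Q (nat \<bar>v0 x\<bar>)"
      using v0 by (simp add: Q_def)
    then have Q: "Q (LEAST g. Q g)"
      by (rule LeastI)
    define g where "g = (LEAST g. Q g)"
    obtain w where w: "w \<in> M" "w x = int g" and g: "0 < g"
      using Q by (auto simp: Q_def g_def)
    define q where "q v = v x div int g" for v :: "'a \<Rightarrow> int"
    define r where "r v = (\<lambda>p. 1 * v p + (- q v) * w p)" for v
    have rM: "r v \<in> M" if "v \<in> M" for v
      unfolding r_def by (rule int_submodule_combination[OF insert.prems(1) that w(1)])
    have r_mod: "r v x = v x mod int g" for v
      by (simp add: r_def q_def w minus_div_mult_eq_mod)
    have r0: "r v x = 0" if "v \<in> M" for v
    proof (rule ccontr)
      assume "r v x \<noteq> 0"
      moreover have "0 \<le> r v x" "r v x < int g"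
        unfolding r_mod using g by simp_all
      ultimately have *: "0 < r v x" "r v x < int g"
        by simp_all
      then have "Q (nat (r v x))"
        using rM[OF that] by (auto simp: Q_def)
      then have "g \<le> nat (r v x)"
        unfolding g_def by (rule Least_le)
      then show False
        using * by linarith
    qed
    have q_lin: "q (\<lambda>p. c * u p + e * v p) = c * q u + e * q v" if "u \<in> M" "v \<in> M" for c e u v
    proof -
      have *: "u x = q u * int g" "v x = q v * int g"
        using r0 that by (simp_all add: r_def w)
      have "c * u x + e * v x = (c * q u + e * q v) * int g"
        unfolding * by (simp add: algebra_simps)
      then show ?thesis
        using g by (simp add: q_def)
    qed
    define M0 where "M0 = {v\<in>M. v x = 0}"
    have "int_submodule M0" "M0 \<subseteq> supported_on X"
      using insert.prems by (auto simp: M0_def int_submodule_def supported_on_def)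
    then obtain n b f where bf: "\<And>i. i < (n::nat) \<Longrightarrow> b i \<in> M0 \<and> functional_on M0 (f i)"
      "\<And>v. v \<in> M0 \<Longrightarrow> v = (\<lambda>p. \<Sum>i<n. f i v * b i p)"
      using insert.IH[of M0] by blast
    define b' where "b' = b(n := w)"
    define f' where "f' i v = (if i = n then q v else f i (r v))" for i v
    have r_lin: "r (\<lambda>p. c * u p + e * v p) = (\<lambda>p. c * r u p + e * r v p)"
      if "u \<in> M" "v \<in> M" for c e u v
      using q_lin[OF that] by (simp add: r_def algebra_simps)
    have rM0: "r v \<in> M0" if "v \<in> M" for v
      using rM r0 that by (simp add: M0_def)
    have "b' i \<in> M \<and> functional_on M (f' i)" if "i < Suc n" for i
    proof (cases "i = n")
      case True
      then show ?thesis
        using w q_lin by (simp add: b'_def f'_def functional_on_def)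
    next
      case False
      then show ?thesis
        using bf(1)[of i] that rM0 by (auto simp: b'_def f'_def functional_on_def r_lin M0_def)
    qed
    moreover have "v = (\<lambda>p. \<Sum>i<Suc n. f' i v * b' i p)" if "v \<in> M" for v
    proof
      fix p
      have "r v p = (\<Sum>i<n. f i (r v) * b i p)"
        using bf(2)[OF rM0[OF that]] by (rule fun_cong)
      then show "v p = (\<Sum>i<Suc n. f' i v * b' i p)"
        by (simp add: f'_def b'_def r_def)
    qed
    ultimately show ?thesis
      by blast
  qed
qed

definition delta :: "'a \<Rightarrow> 'a \<Rightarrow> int" where
  "delta x = (\<lambda>p. if p = x then 1 else 0)"

lemma supported_on_expand:
  assumes "finite X" "v \<in> supported_on X"
  shows "v = (\<lambda>p. \<Sum>x\<in>X. v x * delta x p)"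
proof
  fix p
  have "(\<Sum>x\<in>X. v x * delta x p) = (\<Sum>x\<in>X. if p = x then v x else 0)"
    by (rule sum.cong) (auto simp: delta_def)
  then show "v p = (\<Sum>x\<in>X. v x * delta x p)"
    using assms by (simp add: supported_on_def)
qed

section \<open>Traces of powers as integer combinations of powers\<close>

text \<open>The sum is the trace of \<open>P T^r\<close> on the functions supported on
  \<open>X\<close>. Splitting each basis vector by the operators \<open>W m\<close> multiplies it by
  \<open>D\<close> and turns \<open>T^r\<close> into \<open>m^r\<close>. Each trace of
  \<open>P W m\<close> is \<open>D\<close> times the trace of \<open>P\<close> on the eigenlattice
  of \<open>m\<close>, an integer, so \<open>D\<close> cancels.\<close>

theorem trace_power_integer_spectrum:
  fixes T P :: "('a \<Rightarrow> int) \<Rightarrow> ('a \<Rightarrow> int)"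
  assumes T: "linear_op T" and P: "linear_op P" and X: "finite X"
    and invT: "\<And>v. v \<in> supported_on X \<Longrightarrow> T v \<in> supported_on X"
    and invP: "\<And>v. v \<in> supported_on X \<Longrightarrow> P v \<in> supported_on X"
    and com: "\<And>v. P (T v) = T (P v)"
    and ms: "distinct ms" "\<And>v. v \<in> supported_on X \<Longrightarrow> shifts T ms v = (\<lambda>_. 0)"
  shows "\<exists>a. \<forall>r. (\<Sum>x\<in>X. P ((T ^^ r) (delta x)) x) = (\<Sum>m\<in>set ms. a m * m ^ r)"
proof -
  obtain D W where D: "D \<noteq> 0"
    and W1: "\<forall>m\<in>set ms. linear_op (W m) \<and> (\<forall>v\<in>supported_on X. W m v \<in> supported_on X) \<and>
        (\<forall>v. shift T m v = (\<lambda>_. 0) \<longrightarrow> W m v = (\<lambda>p. D * v p))"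
    and W2: "\<forall>v. shifts T ms v = (\<lambda>_. 0) \<longrightarrow> (\<forall>m\<in>set ms. shift T m (W m v) = (\<lambda>_. 0)) \<and>
        (\<forall>p. (\<Sum>m\<in>set ms. W m v p) = D * v p)"
    using eigenspace_decomposition[of T X, OF T invT ms(1)] by blast
  have W: "\<And>m. m \<in> set ms \<Longrightarrow> linear_op (W m)"
      "\<And>m v. m \<in> set ms \<Longrightarrow> v \<in> supported_on X \<Longrightarrow> W m v \<in> supported_on X"
      "\<And>m v. m \<in> set ms \<Longrightarrow> shift T m v = (\<lambda>_. 0) \<Longrightarrow> W m v = (\<lambda>p. D * v p)"
      "\<And>m v. m \<in> set ms \<Longrightarrow> v \<in> supported_on X \<Longrightarrow> shift T m (W m v) = (\<lambda>_. 0)"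
      "\<And>v p. v \<in> supported_on X \<Longrightarrow> (\<Sum>m\<in>set ms. W m v p) = D * v p"
    using W1 W2 ms(2) by blast+
  have delta_supp: "delta x \<in> supported_on X" if "x \<in> X" for x
    using that by (auto simp: delta_def supported_on_def)
  have "\<exists>a. (\<Sum>x\<in>X. P (W m (delta x)) x) = D * a" if m: "m \<in> set ms" for m
  proof -
    define M where "M = {v \<in> supported_on X. shift T m v = (\<lambda>_. 0)}"
    have M: "int_submodule M" "M \<subseteq> supported_on X"
      by (auto simp: M_def int_submodule_def supported_on_def linear_op_combination[OF linear_op_shift[OF T]]
          linear_op_zero[OF linear_op_shift[OF T]])
    obtain n b f where b: "\<And>i. i < (n::nat) \<Longrightarrow> b i \<in> M"
      and f: "\<And>i. i < n \<Longrightarrow> functional_on M (f i)"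
      and bf: "\<And>v. v \<in> M \<Longrightarrow> v = (\<lambda>p. \<Sum>i<n. f i v * b i p)"
      using dual_basis[OF X M] by blast
    have WM: "W m v \<in> M" if "v \<in> supported_on X" for v
      using W(2,4)[OF m] that by (simp add: M_def)
    have PM: "P v \<in> M" if "v \<in> M" for v
      using that invP op_shift_commute[of P T, OF P com, of m v]
      by (simp add: M_def linear_op_zero[OF P])
    \<comment> \<open>Cyclicity of the trace in coordinates: expanding \<open>W m (delta x)\<close>
      in the vectors \<open>b i\<close> and summing over \<open>x\<close> first leaves the
      coordinates \<open>f i\<close> of \<open>W m (P (b i))\<close>, where \<open>W m\<close> is
      multiplication by \<open>D\<close>.\<close>
    have "(\<Sum>x\<in>X. P (W m (delta x)) x) = (\<Sum>x\<in>X. \<Sum>i<n. f i (W m (delta x)) * P (b i) x)"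
    proof (rule sum.cong)
      fix x assume "x \<in> X"
      then have "P (W m (delta x)) = P (\<lambda>p. \<Sum>i<n. f i (W m (delta x)) * b i p)"
        using bf[OF WM[OF delta_supp]] by simp
      then show "P (W m (delta x)) x = (\<Sum>i<n. f i (W m (delta x)) * P (b i) x)"
        by (simp add: linear_op_sum[OF P])
    qed simp
    also have "\<dots> = (\<Sum>i<n. \<Sum>x\<in>X. P (b i) x * f i (W m (delta x)))"
      by (subst sum.swap) (simp add: mult.commute)
    also have "\<dots> = (\<Sum>i<n. f i (\<lambda>p. \<Sum>x\<in>X. P (b i) x * W m (delta x) p))"
      using functional_on_sum[OF M(1) f _ X] WM delta_supp by (intro sum.cong) simp_all
    also have "\<dots> = (\<Sum>i<n. f i (W m (P (b i))))"
    proof (intro sum.cong)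
      fix i assume i: "i \<in> {..<n}"
      have "P (b i) \<in> supported_on X"
        using PM b i M by blast
      then show "f i (\<lambda>p. \<Sum>x\<in>X. P (b i) x * W m (delta x) p) = f i (W m (P (b i)))"
        by (subst (3) supported_on_expand[OF X]) (simp_all add: linear_op_sum[OF W(1)[OF m]])
    qed simp
    also have "\<dots> = (\<Sum>i<n. D * f i (P (b i)))"
    proof (intro sum.cong)
      fix i assume i: "i \<in> {..<n}"
      then have PbM: "P (b i) \<in> M"
        using PM b by simp
      then have "W m (P (b i)) = (\<lambda>p. D * P (b i) p + 0 * P (b i) p)"
        using W(3)[OF m] by (simp add: M_def)
      moreover have "f i (\<lambda>p. D * P (b i) p + 0 * P (b i) p) = D * f i (P (b i)) + 0 * f i (P (b i))"
        using f[unfolded functional_on_def, rule_format, of i "P (b i)" "P (b i)" D 0] i PbM by simp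
      ultimately show "f i (W m (P (b i))) = D * f i (P (b i))"
        by simp
    qed simp
    finally show ?thesis
      by (auto simp flip: sum_distrib_left)
  qed
  then obtain a where a: "\<And>m. m \<in> set ms \<Longrightarrow> (\<Sum>x\<in>X. P (W m (delta x)) x) = D * a m"
    by metis
  have "(\<Sum>x\<in>X. P ((T ^^ r) (delta x)) x) = (\<Sum>m\<in>set ms. a m * m ^ r)" for r
  proof -
    have pow: "(T ^^ r) v = (\<lambda>p. m ^ r * v p)" if "shift T m v = (\<lambda>_. 0)" for m v
    proof (induction r)
      case (Suc r)
      have "T v = (\<lambda>p. m * v p)"
        using that by (simp add: shift_def fun_eq_iff)
      then show ?case
        by (simp add: Suc linear_op_scale[OF T]) (simp add: mult_ac)
    qed simp
    have "D * P ((T ^^ r) (delta x)) x = (\<Sum>m\<in>set ms. m ^ r * P (W m (delta x)) x)" if "x \<in> X" for x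
    proof -
      have "(\<lambda>p. D * P ((T ^^ r) (delta x)) p) = P ((T ^^ r) (\<lambda>p. D * delta x p))"
        by (simp add: linear_op_scale[OF P] linear_op_scale[OF linear_op_funpow[OF T]])
      also have "(\<lambda>p. D * delta x p) = (\<lambda>p. \<Sum>m\<in>set ms. 1 * W m (delta x) p)"
        using W(5)[OF delta_supp[OF that]] by simp
      also have "(T ^^ r) \<dots> = (\<lambda>p. \<Sum>m\<in>set ms. 1 * (T ^^ r) (W m (delta x)) p)"
        by (rule linear_op_sum[OF linear_op_funpow[OF T]])
      also have "\<dots> = (\<lambda>p. \<Sum>m\<in>set ms. m ^ r * W m (delta x) p)"
        using pow[OF W(4)[OF _ delta_supp[OF that]]] by simp
      finally show ?thesis
        by (simp add: linear_op_sum[OF P] fun_eq_iff)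
    qed
    then have "D * (\<Sum>x\<in>X. P ((T ^^ r) (delta x)) x) =
        (\<Sum>x\<in>X. \<Sum>m\<in>set ms. m ^ r * P (W m (delta x)) x)"
      by (simp add: sum_distrib_left)
    also have "\<dots> = (\<Sum>m\<in>set ms. m ^ r * (\<Sum>x\<in>X. P (W m (delta x)) x))"
      by (subst sum.swap) (simp add: sum_distrib_left)
    also have "\<dots> = D * (\<Sum>m\<in>set ms. a m * m ^ r)"
      by (simp add: a sum_distrib_left mult_ac)
    finally show ?thesis
      using D by simp
  qed
  then show ?thesis
    by blast
qed

section \<open>Sums of transpositions acting on the group ring\<close>

text \<open>For a finite set of permutations this is right multiplication by the sum of their
  inverses; for involutions it is right multiplication by their sum.\<close>

definition right_op :: "('a \<Rightarrow> 'a) set \<Rightarrow> (('a \<Rightarrow> 'a) \<Rightarrow> int) \<Rightarrow> (('a \<Rightarrow> 'a) \<Rightarrow> int)" where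
  "right_op S v = (\<lambda>p. \<Sum>t\<in>S. v (p \<circ> t))"

lemma linear_op_right_op: "linear_op (right_op S)"
  by (rule linear_opI) (simp add: right_op_def sum.distrib sum_distrib_left)

text \<open>Conjugation by each \<open>t\<close> permutes \<open>S\<close>, so moving
  \<open>t\<close> past the sum over \<open>S\<close> only reorders the sum.\<close>

lemma right_op_commute:
  assumes "\<And>t. t \<in> S' \<Longrightarrow> bij t"
    and "\<And>s t. s \<in> S \<Longrightarrow> t \<in> S' \<Longrightarrow> t \<circ> s \<circ> inv' t \<in> S"
    and "\<And>s t. s \<in> S \<Longrightarrow> t \<in> S' \<Longrightarrow> inv' t \<circ> s \<circ> t \<in> S"
  shows "right_op S (right_op S' v) = right_op S' (right_op S v)"
proof
  fix p
  have *: "(\<Sum>s\<in>S. v (p \<circ> s \<circ> t)) = (\<Sum>s\<in>S. v (p \<circ> t \<circ> s))" if t: "t \<in> S'" for t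
  proof (rule sum.reindex_bij_witness[of _ "\<lambda>s. t \<circ> s \<circ> inv' t" "\<lambda>s. inv' t \<circ> s \<circ> t"])
    have t1: "t (inv' t x) = x" "inv' t (t x) = x" for x
      using assms(1)[OF t] by (simp_all add: bij_is_surj surj_f_inv_f bij_is_inj)
    show "t \<circ> (inv' t \<circ> s \<circ> t) \<circ> inv' t = s" "inv' t \<circ> (t \<circ> s \<circ> inv' t) \<circ> t = s" for s
      by (simp_all add: fun_eq_iff t1)
    show "v (p \<circ> t \<circ> (inv' t \<circ> s \<circ> t)) = v (p \<circ> s \<circ> t)" for s
      by (rule arg_cong[of _ _ v]) (simp add: fun_eq_iff t1)
  qed (use assms t in auto)
  have "right_op S (right_op S' v) p = (\<Sum>t\<in>S'. \<Sum>s\<in>S. v (p \<circ> s \<circ> t))"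
    unfolding right_op_def by (rule sum.swap)
  also have "\<dots> = right_op S' (right_op S v) p"
    by (simp add: right_op_def *)
  finally show "right_op S (right_op S' v) p = right_op S' (right_op S v) p" .
qed

section \<open>Conjugated transpositions and Jucys--Murphy elements\<close>

lemma comp_transpose:
  assumes "inj f"
  shows "f \<circ> transpose a b = transpose (f a) (f b) \<circ> f"
  using assms by (auto simp: fun_eq_iff transpose_def inj_eq)

lemma conj_transpose:
  assumes "bij f"
  shows "f \<circ> transpose a b \<circ> inv' f = transpose (f a) (f b)"
proof -
  have "f \<circ> transpose a b \<circ> inv' f = transpose (f a) (f b) \<circ> (f \<circ> inv' f)"
    using comp_transpose[OF bij_is_inj[OF assms]] by (simp add: comp_assoc)
  then show ?thesis
    using surj_iff[of f] bij_is_surj[OF assms] by simp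
qed

lemma conj_inv_transpose:
  assumes "bij f"
  shows "inv' f \<circ> transpose a b \<circ> f = transpose (inv' f a) (inv' f b)"
  using conj_transpose[OF bij_imp_bij_inv[OF assms]] inv_inv_eq[OF assms] by metis

text \<open>For \<open>A = {1..<x}\<close> the operator of this set is right multiplication by a
  Jucys--Murphy element.\<close>

definition star :: "'a set \<Rightarrow> 'a \<Rightarrow> ('a \<Rightarrow> 'a) set" where
  "star A x = (\<lambda>a. transpose a x) ` A"

lemma inj_on_transpose_left: "inj (\<lambda>a. transpose a x)"
proof (rule injI)
  fix a b assume "transpose a x = transpose b x"
  then have "transpose a x x = transpose b x x"
    by simp
  then show "a = b"
    by simp
qed

lemma right_op_star: "right_op (star A x) v p = (\<Sum>a\<in>A. v (p \<circ> transpose a x))"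
  unfolding right_op_def star_def
  by (subst sum.reindex) (auto intro: inj_on_subset[OF inj_on_transpose_left])

text \<open>When \<open>y\<close> is added to the set, the sum \<open>L\<close> at \<open>x\<close>
  is related to the sum \<open>J\<close> over the old set at \<open>y\<close> by
  \<open>L = s J s + s\<close> with \<open>s\<close> the transposition of \<open>x\<close> and
  \<open>y\<close>. These are the relations of \<open>integer_spectrum_hecke_step\<close>; the
  induction hypothesis is used at the point \<open>y\<close> instead of \<open>x\<close>.\<close>

lemma integer_spectrum_star:
  assumes "finite A" "x \<notin> A"
  shows "integer_spectrum (right_op (star A x))"
  using assms
proof (induction A arbitrary: x rule: finite_induct)
  case empty
  have "shifts (right_op (star {} x)) [0] v = (\<lambda>_. 0)" for v :: "('a \<Rightarrow> 'a) \<Rightarrow> int"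
    by (simp add: shift_def right_op_def star_def)
  then show ?case
    unfolding integer_spectrum_def by blast
next
  case (insert y A)
  let ?J = "right_op (star A y)" and ?L = "right_op (star (insert y A) x)"
    and ?s = "right_op {transpose x y}"
  have xy: "x \<noteq> y" "x \<notin> A" "y \<notin> A"
    using insert by auto
  have s: "?s v p = v (p \<circ> transpose x y)" for v p
    by (simp add: right_op_def)
  have L: "?L v p = (\<Sum>a\<in>A. v (p \<circ> transpose a x)) + v (p \<circ> transpose x y)" for v p
    using insert by (simp add: right_op_star transpose_commute)
  show ?case
  proof (rule integer_spectrum_hecke_step[of ?J ?L ?s])
    \<comment> \<open>The transpositions in \<open>star A y\<close> fix \<open>x\<close> and map
      \<open>insert y A\<close> to itself, so conjugation by them preserves the star at
      \<open>x\<close>.\<close>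
    show "?J (?L v) = ?L (?J v)" for v
    proof (rule right_op_commute[symmetric])
      fix s t assume "s \<in> star (insert y A) x" "t \<in> star A y"
      then obtain a b where ab: "s = transpose a x" "a \<in> insert y A" "t = transpose b y" "b \<in> A"
        by (auto simp: star_def)
      have "t x = x" "t a \<in> insert y A"
        using ab xy by (auto simp: transpose_def)
      then have "transpose (t a) (t x) \<in> star (insert y A) x"
        by (auto simp: star_def)
      moreover have "bij t" "inv' t = t"
        by (simp_all add: ab)
      ultimately show "t \<circ> s \<circ> inv' t \<in> star (insert y A) x" "inv' t \<circ> s \<circ> t \<in> star (insert y A) x"
        using conj_transpose[of t a x] conj_inv_transpose[of t a x] ab by simp_all
    qed (auto simp: star_def)
    have "transpose x y \<circ> transpose a x = transpose a y \<circ> transpose x y" if "a \<in> A" for a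
      using that xy by (auto simp: transpose_def fun_eq_iff)
    then show "?s (?L v) = (\<lambda>p. ?J (?s v) p + v p)" for v
      by (intro ext) (simp add: s L right_op_star[of A] comp_assoc)
    have "transpose a x \<circ> transpose x y = transpose x y \<circ> transpose a y" if "a \<in> A" for a
      using that xy by (auto simp: transpose_def fun_eq_iff)
    then show "?L (?s v) = (\<lambda>p. ?s (?J v) p + v p)" for v
      by (intro ext) (simp add: s L right_op_star[of A] comp_assoc)
    show "?s (?s v) = v" for v
      by (simp add: s fun_eq_iff comp_assoc)
    show "integer_spectrum ?J"
      using insert by simp
  qed (rule linear_op_right_op)+
qed

section \<open>Sums of the transpositions in a Young subgroup\<close>

definition inner_transpositions :: "('a \<times> 'a) set \<Rightarrow> 'a set \<Rightarrow> ('a \<Rightarrow> 'a) set" where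
  "inner_transpositions R B = {transpose a b | a b. a \<in> B \<and> b \<in> B \<and> a \<noteq> b \<and> (a, b) \<in> R}"

lemma finite_inner_transpositions:
  assumes "finite B"
  shows "finite (inner_transpositions R B)"
proof (rule finite_subset)
  show "inner_transpositions R B \<subseteq> (\<lambda>(a, b). transpose a b) ` (B \<times> B)"
    by (auto simp: inner_transpositions_def)
  show "finite ((\<lambda>(a, b). transpose a b) ` (B \<times> B))"
    using assms by blast
qed

lemma inner_transpositions_insert:
  assumes "sym R"
  shows "inner_transpositions R (insert x B) =
    inner_transpositions R B \<union> star {a \<in> B - {x}. (a, x) \<in> R} x"
proof (intro equalityI subsetI)
  fix t assume "t \<in> inner_transpositions R (insert x B)"
  then obtain a b where ab: "t = transpose a b" "a \<in> insert x B" "b \<in> insert x B" "a \<noteq> b" "(a, b) \<in> R"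
    by (auto simp: inner_transpositions_def)
  consider "a = x" | "b = x" | "a \<noteq> x" "b \<noteq> x"
    by blast
  then show "t \<in> inner_transpositions R B \<union> star {a \<in> B - {x}. (a, x) \<in> R} x"
  proof cases
    case 1
    then have "b \<in> {a \<in> B - {x}. (a, x) \<in> R}" "t = transpose b x"
      using ab assms by (auto simp: transpose_commute dest: symD)
    then show ?thesis
      by (auto simp: star_def)
  qed (use ab in \<open>auto simp: inner_transpositions_def star_def\<close>)
next
  fix t assume "t \<in> inner_transpositions R B \<union> star {a \<in> B - {x}. (a, x) \<in> R} x"
  then show "t \<in> inner_transpositions R (insert x B)"
    by (fastforce simp: inner_transpositions_def star_def)
qed

text \<open>Points are added one at a time. The new transpositions form the star at \<open>x\<close>
  over the points of \<open>B\<close> related to \<open>x\<close>. The earlier transpositions fix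
  \<open>x\<close> and preserve that set of points, so the two sums commute and
  \<open>integer_spectrum_add\<close> applies.\<close>

lemma integer_spectrum_inner_transpositions:
  assumes "finite B" "sym R" "trans R"
  shows "integer_spectrum (right_op (inner_transpositions R B))"
  using assms(1)
proof (induction B rule: finite_induct)
  case empty
  have "shifts (right_op (inner_transpositions R {})) [0] v = (\<lambda>_. 0)" for v
    by (simp add: shift_def right_op_def inner_transpositions_def)
  then show ?case
    unfolding integer_spectrum_def by blast
next
  case (insert x B)
  define A where "A = {a \<in> B. (a, x) \<in> R}"
  let ?T = "inner_transpositions R B"
  have A: "{a \<in> B - {x}. (a, x) \<in> R} = A" "finite A" "x \<notin> A"
    using insert by (auto simp: A_def)
  \<comment> \<open>Earlier transpositions fix \<open>x\<close> and the new ones move it, so the two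
    sets are disjoint and their operators add.\<close>
  have fixes_x: "t x = x" if "t \<in> ?T" for t
    using that insert by (auto simp: inner_transpositions_def transpose_def)
  have moves_x: "t x \<noteq> x" if "t \<in> star A x" for t
    using that A by (auto simp: star_def)
  have "right_op (inner_transpositions R (insert x B)) = (\<lambda>v p. right_op ?T v p + right_op (star A x) v p)"
    unfolding inner_transpositions_insert[OF assms(2)] A(1) right_op_def
    using fixes_x moves_x insert A finite_inner_transpositions[of B R]
    by (intro ext sum.union_disjoint) (auto simp: star_def)
  moreover have "integer_spectrum (\<lambda>v p. right_op ?T v p + right_op (star A x) v p)"
  proof (rule integer_spectrum_add[OF linear_op_right_op linear_op_right_op])
    show "right_op ?T (right_op (star A x) v) = right_op (star A x) (right_op ?T v)" for v
    proof (rule right_op_commute[symmetric])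
      fix s t assume st: "s \<in> star A x" "t \<in> ?T"
      then obtain c a b where c: "s = transpose c x" "c \<in> A" and ab: "t = transpose a b" "a \<in> B"
        "b \<in> B" "a \<noteq> b" "(a, b) \<in> R"
        by (auto simp: star_def inner_transpositions_def)
      have "(b, a) \<in> R"
        using ab assms(2) by (auto dest: symD)
      then have "t c \<in> A"
        using c ab assms(3) by (auto simp: A_def transpose_def dest: transD)
      then have "transpose (t c) (t x) \<in> star A x"
        using fixes_x[OF st(2)] by (auto simp: star_def)
      moreover have "bij t" "inv' t = t"
        by (simp_all add: ab)
      ultimately show "t \<circ> s \<circ> inv' t \<in> star A x" "inv' t \<circ> s \<circ> t \<in> star A x"
        using conj_transpose[of t c x] conj_inv_transpose[of t c x] c by simp_all
    qed (auto simp: inner_transpositions_def)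
  qed (use insert.IH integer_spectrum_star[OF A(2,3)] in simp_all)
  ultimately show ?case
    by simp
qed

section \<open>Eigenvalue bound and diagonalizability on the group ring\<close>

context
  fixes B :: "'a set" and S :: "('a \<Rightarrow> 'a) set"
  assumes finB: "finite B" and S: "S \<subseteq> {p. p permutes B}"
begin

lemma right_op_supported:
  assumes "v \<in> supported_on {p. p permutes B}"
  shows "right_op S v \<in> supported_on {p. p permutes B}"
proof -
  have "p permutes B" if "p \<circ> t permutes B" "t \<in> S" for p t
  proof -
    have t: "t permutes B"
      using S that by auto
    have "p \<circ> t \<circ> inv' t permutes B"
      by (rule permutes_compose[OF permutes_inv[OF t] that(1)])
    then show ?thesis
      by (simp add: comp_assoc permutes_inv_o[OF t])
  qed
  then show ?thesis
    using assms by (auto simp: supported_on_def right_op_def intro!: sum.neutral)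
qed

lemma finite_perms: "finite {p. p permutes B}" "finite S"
  using finB S finite_permutations by (auto intro: finite_subset)

text \<open>Evaluate the eigenvalue equation at a permutation where the absolute value of
  \<open>v\<close> is maximal: the right side is at most \<open>card S\<close> times that
  maximum.\<close>

lemma eigenvalue_le_card:
  assumes "v \<in> supported_on {p. p permutes B}" "shift (right_op S) m v = (\<lambda>_. 0)" "int (card S) < \<bar>m\<bar>"
  shows "v = (\<lambda>_. 0)"
proof -
  let ?X = "{p. p permutes B}"
  define M where "M = Max ((\<lambda>p. \<bar>v p\<bar>) ` ?X)"
  have ne: "?X \<noteq> {}"
    using permutes_id by blast
  have le: "\<bar>v p\<bar> \<le> M" if "p \<in> ?X" for p
    unfolding M_def using finite_perms that by simp
  have "M \<in> (\<lambda>p. \<bar>v p\<bar>) ` ?X"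
    unfolding M_def using finite_perms ne by (intro Max_in) auto
  then obtain p where p: "p \<in> ?X" "\<bar>v p\<bar> = M"
    by auto
  have "\<bar>m\<bar> * M = \<bar>right_op S v p\<bar>"
    using assms(2) p(2) by (simp add: shift_def fun_eq_iff abs_mult flip: p(2))
  also have "\<dots> \<le> (\<Sum>t\<in>S. \<bar>v (p \<circ> t)\<bar>)"
    unfolding right_op_def by (rule sum_abs)
  also have "\<dots> \<le> (\<Sum>t\<in>S. M)"
    using p S by (intro sum_mono le) (auto intro: permutes_compose)
  finally have "(\<bar>m\<bar> - int (card S)) * M \<le> 0"
    by (simp add: algebra_simps)
  then have "M \<le> 0"
    using assms(3) by (simp add: mult_le_0_iff)
  then have "v p = 0" if "p \<in> ?X" for p
    using le[OF that] by simp
  then show ?thesis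
    using assms(1) by (auto simp: supported_on_def)
qed

lemma right_op_symmetric:
  assumes "\<And>t. t \<in> S \<Longrightarrow> t \<circ> t = id"
  shows "(\<Sum>p | p permutes B. right_op S v p * w p) = (\<Sum>p | p permutes B. v p * right_op S w p)"
proof -
  have "(\<Sum>p | p permutes B. v (p \<circ> t) * w p) = (\<Sum>p | p permutes B. v p * w (p \<circ> t))" if "t \<in> S" for t
    using assms[OF that] S that
    by (intro sum.reindex_bij_witness[of _ "\<lambda>p. p \<circ> t" "\<lambda>p. p \<circ> t"])
      (auto simp: comp_assoc intro: permutes_compose)
  then have "(\<Sum>t\<in>S. \<Sum>p | p permutes B. v (p \<circ> t) * w p) = (\<Sum>t\<in>S. \<Sum>p | p permutes B. v p * w (p \<circ> t))"
    by simp
  then show ?thesis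
    by (simp add: right_op_def sum_distrib_left sum_distrib_right sum.swap[of _ S])
qed

text \<open>With \<open>T\<close> the operator of \<open>S\<close> and \<open>u = (T - m) v\<close>,
  symmetry turns the sum of the squares of \<open>u\<close> into the pairing of \<open>v\<close>
  with \<open>(T - m) u\<close>, which is zero.\<close>

lemma eigenspace_semisimple:
  assumes "\<And>t. t \<in> S \<Longrightarrow> t \<circ> t = id" and v: "v \<in> supported_on {p. p permutes B}"
    and "shift (right_op S) m (shift (right_op S) m v) = (\<lambda>_. 0)"
  shows "shift (right_op S) m v = (\<lambda>_. 0)"
proof -
  let ?u = "shift (right_op S) m v"
  have "(\<Sum>p | p permutes B. ?u p * ?u p) =
      (\<Sum>p | p permutes B. right_op S v p * ?u p) - (\<Sum>p | p permutes B. m * v p * ?u p)"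
    by (simp add: shift_def left_diff_distrib sum_subtractf)
  also have "\<dots> = (\<Sum>p | p permutes B. v p * shift (right_op S) m ?u p)"
    by (simp add: right_op_symmetric[OF assms(1)] shift_def[of _ _ ?u] right_diff_distrib sum_subtractf mult_ac)
  also have "\<dots> = 0"
    using assms(3) by simp
  finally have "\<forall>p\<in>{p. p permutes B}. ?u p * ?u p = 0"
    using finite_perms by (subst (asm) sum_nonneg_eq_0_iff) auto
  moreover have "?u p = 0" if "\<not> p permutes B" for p
    using right_op_supported[OF v] v that by (auto simp: shift_def supported_on_def)
  ultimately show ?thesis
    by (auto simp: fun_eq_iff)
qed

lemma integer_spectrum_squarefree:
  assumes inv: "\<And>t. t \<in> S \<Longrightarrow> t \<circ> t = id" and spec: "integer_spectrum (right_op S)"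
  shows "\<exists>ms. distinct ms \<and> set ms \<subseteq> {- int (card S)..int (card S)} \<and>
    (\<forall>v\<in>supported_on {p. p permutes B}. shifts (right_op S) ms v = (\<lambda>_. 0))"
proof -
  let ?T = "right_op S" and ?V = "supported_on {p. p permutes B}"
  let ?good = "\<lambda>m. \<bar>m\<bar> \<le> int (card S)"
  note lin = linear_op_right_op[of S]
  have shift_V: "shift ?T m v \<in> ?V" if "v \<in> ?V" for m v
    using right_op_supported[OF that] that by (auto simp: shift_def supported_on_def)
  have shifts_V: "shifts ?T ms v \<in> ?V" if "v \<in> ?V" for ms v
    using that by (induction ms arbitrary: v) (auto simp: shift_V)
  obtain ms where ms: "\<And>v. shifts ?T ms v = (\<lambda>_. 0)"
    using spec by (auto simp: integer_spectrum_def)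
  have bounded: "shifts ?T (filter ?good ms) v = (\<lambda>_. 0)"
    if "v \<in> ?V" "shifts ?T ms v = (\<lambda>_. 0)" for ms v
    using that
  proof (induction ms arbitrary: v)
    case (Cons m ms)
    then have *: "shifts ?T (filter ?good ms) (shift ?T m v) = (\<lambda>_. 0)"
      by (simp add: shift_V)
    show ?case
    proof (cases "?good m")
      case False
      then show ?thesis
        using * eigenvalue_le_card[of "shifts ?T (filter ?good ms) v" m] shifts_V[OF Cons.prems(1)]
        by (simp add: shift_shifts[OF lin])
    qed (use * in simp)
  qed simp
  \<comment> \<open>A further factor \<open>T - m\<close> next to the one already in
    \<open>ns\<close> makes a square \<open>(T - m)^2\<close>, which
    \<open>eigenspace_semisimple\<close> reduces to a single factor.\<close>
  have redundant: "shifts ?T ns v = (\<lambda>_. 0)"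
    if v: "v \<in> ?V" and m: "m \<in> set ns" and ns: "shifts ?T ns (shift ?T m v) = (\<lambda>_. 0)" for m ns v
  proof -
    obtain xs ys where "ns = xs @ m # ys"
      using m by (auto simp: in_set_conv_decomp)
    then show ?thesis
      using ns eigenspace_semisimple[OF inv shifts_V[OF v], of m "xs @ ys"]
      by (simp add: shifts_swap[OF lin] flip: shift_shifts[OF lin])
  qed
  have distinct: "shifts ?T (remdups ms) v = (\<lambda>_. 0)"
    if "v \<in> ?V" "shifts ?T ms v = (\<lambda>_. 0)" for ms v
    using that
  proof (induction ms arbitrary: v)
    case (Cons m ms)
    then show ?case
      using redundant[of v m "remdups ms"] by (simp add: shift_V)
  qed simp
  show ?thesis
    using bounded[OF _ ms] distinct by (intro exI[of _ "remdups (filter ?good ms)"]) auto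
qed

end

section \<open>Counting factorizations by traces\<close>

lemma right_op_funpow:
  assumes "finite S"
  shows "(right_op S ^^ r) v p = (\<Sum>ts | set ts \<subseteq> S \<and> length ts = r. v (p \<circ> foldr (\<circ>) ts id))"
proof (induction r arbitrary: p)
  case 0
  have "{ts. set ts \<subseteq> S \<and> length ts = 0} = {[]}"
    by auto
  then show ?case
    by simp
next
  case (Suc r)
  let ?W = "{ts. set ts \<subseteq> S \<and> length ts = r}"
  have "(\<Sum>ts | set ts \<subseteq> S \<and> length ts = Suc r. v (p \<circ> foldr (\<circ>) ts id)) =
      (\<Sum>(ts, t)\<in>?W \<times> S. v (p \<circ> foldr (\<circ>) (t # ts) id))"
    unfolding lists_length_Suc_eq by (subst sum.reindex) (auto simp: inj_on_def split_def)
  also have "\<dots> = (\<Sum>t\<in>S. \<Sum>ts\<in>?W. v (p \<circ> t \<circ> foldr (\<circ>) ts id))"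
    by (subst sum.swap) (simp add: sum.cartesian_product comp_assoc)
  finally have "(\<Sum>ts | set ts \<subseteq> S \<and> length ts = Suc r. v (p \<circ> foldr (\<circ>) ts id)) =
      (\<Sum>t\<in>S. (right_op S ^^ r) v (p \<circ> t))"
    by (simp only: Suc)
  moreover have "(right_op S ^^ Suc r) v p = (\<Sum>t\<in>S. (right_op S ^^ r) v (p \<circ> t))"
    by (simp add: right_op_def[of S "(right_op S ^^ r) v"])
  ultimately show ?case
    by (simp only:)
qed

text \<open>The diagonal coefficient of \<open>P T^r\<close> at \<open>x\<close> counts the words
  \<open>ts\<close> with \<open>x \<sigma>\<inverse> q = x\<close>, where \<open>q\<close> is the
  product of \<open>ts\<close>, hence those with \<open>q = \<sigma>\<close>. It is the same for
  every \<open>x\<close>, so the trace is \<open>fact (card B)\<close> times the count.\<close>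

theorem count_products_integer_spectrum:
  assumes B: "finite B" and S: "S \<subseteq> {p. p permutes B}" and inv: "\<And>t. t \<in> S \<Longrightarrow> t \<circ> t = id"
    and spec: "integer_spectrum (right_op S)"
    and \<sigma>: "\<sigma> permutes B" "\<And>t. t \<in> S \<Longrightarrow> \<sigma> \<circ> t \<circ> inv' \<sigma> \<in> S" "\<And>t. t \<in> S \<Longrightarrow> inv' \<sigma> \<circ> t \<circ> \<sigma> \<in> S"
    and K: "card S \<le> K"
  shows "\<exists>a. \<forall>r. fact (card B) * int (card {ts. set ts \<subseteq> S \<and> length ts = r \<and> foldr (\<circ>) ts id = \<sigma>}) =
    (\<Sum>m\<in>{- int K..int K}. a m * m ^ r)"
proof -
  let ?X = "{p. p permutes B}" and ?P = "right_op {inv' \<sigma>}" and ?T = "right_op S"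
  note fin = finite_perms[OF B S]
  obtain ms where ms: "distinct ms" "set ms \<subseteq> {- int (card S)..int (card S)}"
    "\<And>v. v \<in> supported_on ?X \<Longrightarrow> shifts ?T ms v = (\<lambda>_. 0)"
    using integer_spectrum_squarefree[OF B S inv spec] by blast
  have inv\<sigma>: "{inv' \<sigma>} \<subseteq> ?X"
    using \<sigma>(1) by (simp add: permutes_inv)
  have com: "?P (?T v) = ?T (?P v)" for v
    using \<sigma> by (intro right_op_commute[symmetric]) (auto simp: permutes_inv_inv permutes_bij[OF permutes_inv])
  have "\<exists>a. \<forall>r. (\<Sum>x\<in>?X. ?P ((?T ^^ r) (delta x)) x) = (\<Sum>m\<in>set ms. a m * m ^ r)"
    by (rule trace_power_integer_spectrum[of ?T ?P ?X ms])
      (simp_all add: linear_op_right_op fin right_op_supported[OF B S] right_op_supported[OF B inv\<sigma>]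
        com ms)
  then obtain a where a: "\<And>r. (\<Sum>x\<in>?X. ?P ((?T ^^ r) (delta x)) x) = (\<Sum>m\<in>set ms. a m * m ^ r)"
    by blast
  have "(?P ((?T ^^ r) (delta x)) x) =
    int (card {ts. set ts \<subseteq> S \<and> length ts = r \<and> foldr (\<circ>) ts id = \<sigma>})" if x: "x \<in> ?X" for x r
  proof -
    have "?P ((?T ^^ r) (delta x)) x =
        (\<Sum>ts | set ts \<subseteq> S \<and> length ts = r. delta x (x \<circ> inv' \<sigma> \<circ> foldr (\<circ>) ts id))"
      by (subst right_op_def) (simp add: right_op_funpow[OF fin(2)])
    also have "\<dots> = (\<Sum>ts | set ts \<subseteq> S \<and> length ts = r. if foldr (\<circ>) ts id = \<sigma> then 1 else 0)"
    proof (rule sum.cong)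
      fix ts
      have "x \<circ> inv' \<sigma> \<circ> q = x \<longleftrightarrow> q = \<sigma>" for q
      proof
        assume "x \<circ> inv' \<sigma> \<circ> q = x"
        then have "\<sigma> \<circ> (inv' x \<circ> x) \<circ> inv' \<sigma> \<circ> q = \<sigma> \<circ> (inv' x \<circ> x)"
          by (simp add: comp_assoc)
        then show "q = \<sigma>"
          using x \<sigma> permutes_inv_o[of x B] permutes_inv_o[of \<sigma> B] by simp
      qed (use \<sigma> in \<open>simp add: comp_assoc permutes_inv_o\<close>)
      then show "delta x (x \<circ> inv' \<sigma> \<circ> foldr (\<circ>) ts id) = (if foldr (\<circ>) ts id = \<sigma> then 1 else 0)"
        by (simp add: delta_def)
    qed simp
    also have "\<dots> = int (card {ts. set ts \<subseteq> S \<and> length ts = r \<and> foldr (\<circ>) ts id = \<sigma>})"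
      using finite_lists_length_eq[OF fin(2), of r] by (simp add: sum.If_cases Int_def conj_assoc)
    finally show ?thesis .
  qed
  then have "(\<Sum>x\<in>?X. ?P ((?T ^^ r) (delta x)) x) = fact (card B) *
      int (card {ts. set ts \<subseteq> S \<and> length ts = r \<and> foldr (\<circ>) ts id = \<sigma>})" for r
    using B by (simp add: card_permutations)
  \<comment> \<open>Zero coefficients extend the sum to an interval depending only on
    \<open>K\<close>, so that counts for different sets \<open>S\<close> can be combined.\<close>
  moreover have "(\<Sum>m\<in>set ms. a m * m ^ r) =
      (\<Sum>m\<in>{- int K..int K}. (if m \<in> set ms then a m else 0) * m ^ r)" for r
    using ms(2) K by (intro sum.mono_neutral_cong_left) auto
  ultimately show ?thesis
    using a by (intro exI[of _ "\<lambda>m. if m \<in> set ms then a m else 0"]) simp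
qed

section \<open>Factorizations with prescribed orbits\<close>

declare One_nat_def [simp del]

lemma foldr_comp_permutes:
  assumes "\<forall>t\<in>set ts. t permutes B"
  shows "foldr (\<circ>) ts id permutes B"
  using assms
proof (induction ts)
  case Nil
  then show ?case
    by (simp add: permutes_def)
next
  case (Cons t ts)
  then have "t permutes B" "\<forall>t\<in>set ts. t permutes B"
    by simp_all
  then have "t \<circ> foldr (\<circ>) ts id permutes B"
    by (intro permutes_compose[OF Cons.IH])
  then show ?case
    unfolding foldr.simps comp_apply .
qed

lemma transpositions_permutes: "t \<in> transpositions d \<Longrightarrow> t permutes {1..d}"
  by (auto simp: transpositions_def permutes_swap_id)

lemma transpositions_involutive: "t \<in> transpositions d \<Longrightarrow> t \<circ> t = id"
  by (auto simp: transpositions_def)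

lemma finite_transpositions: "finite (transpositions d)"
  by (rule finite_subset[OF _ finite_permutations[of "{1..d}"]]) (auto intro: transpositions_permutes)

lemma card_transpositions_le: "card (transpositions d) \<le> d choose 2"
proof -
  let ?P = "{A. A \<subseteq> {1..d} \<and> card A = 2}"
  have "transpositions d \<subseteq> (\<lambda>A. transpose (Min A) (Max A)) ` ?P"
  proof
    fix t assume "t \<in> transpositions d"
    then obtain a b where ab: "t = transpose a b" "a \<in> {1..d}" "b \<in> {1..d}" "a \<noteq> b"
      by (auto simp: transpositions_def)
    then have "t = transpose (Min {a, b}) (Max {a, b})"
      by (cases "a \<le> b") (auto simp: transpose_commute min_def max_def)
    then show "t \<in> (\<lambda>A. transpose (Min A) (Max A)) ` ?P"
      using ab by (intro image_eqI[of _ _ "{a, b}"]) auto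
  qed
  then have "card (transpositions d) \<le> card ?P"
    by (rule surj_card_le[rotated]) simp
  then show ?thesis
    by (simp add: n_subsets)
qed

lemma inner_transpositions_subset: "inner_transpositions R {1..d} \<subseteq> transpositions d"
  by (auto simp: inner_transpositions_def transpositions_def)

section \<open>Orbit relations of groups generated by transpositions\<close>

text \<open>This is the orbit relation of the generated group; transitivity means that it is the
  full relation.\<close>

definition connectivity :: "nat \<Rightarrow> (nat \<Rightarrow> nat) set \<Rightarrow> (nat \<times> nat) set" where
  "connectivity d S = {(x, y). x \<in> {1..d} \<and> (\<exists>p\<in>generate (sym_group d) S. p x = y)}"

lemma generate_permutes:
  assumes "S \<subseteq> transpositions d" "p \<in> generate (sym_group d) S"
  shows "p permutes {1..d}"
proof -
  have "S \<subseteq> carrier (sym_group d)"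
    using assms transpositions_permutes by (auto simp: sym_group_carrier)
  then have "p \<in> carrier (sym_group d)"
    using group.generate_incl[OF sym_group_is_group] assms(2) by blast
  then show ?thesis
    by (simp add: sym_group_carrier)
qed

lemma generate_comp:
  "p \<in> generate (sym_group d) S \<Longrightarrow> q \<in> generate (sym_group d) S \<Longrightarrow> p \<circ> q \<in> generate (sym_group d) S"
  using generate.eng[of p "sym_group d" S q] by (simp add: sym_group_mult)

lemma generate_inv:
  assumes "S \<subseteq> transpositions d" "p \<in> generate (sym_group d) S"
  shows "inv' p \<in> generate (sym_group d) S"
proof -
  have "S \<subseteq> carrier (sym_group d)"
    using assms transpositions_permutes by (auto simp: sym_group_carrier)
  then show ?thesis
    using group.generate_m_inv_closed[OF sym_group_is_group _ assms(2)] generate_permutes[OF assms]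
      sym_group_inv_equality[of p d]
    by (simp add: sym_group_carrier)
qed

lemma equiv_connectivity:
  assumes S: "S \<subseteq> transpositions d"
  shows "equiv {1..d} (connectivity d S)"
proof (rule equivI)
  note perm = generate_permutes[OF S]
  show "connectivity d S \<subseteq> {1..d} \<times> {1..d}"
    using permutes_in_image[OF perm] by (fastforce simp: connectivity_def)
  have "id \<in> generate (sym_group d) S"
    using generate.one[of "sym_group d" S] by (simp add: sym_group_one)
  then show "refl_on {1..d} (connectivity d S)"
    by (auto simp: connectivity_def refl_on_def intro!: bexI[of _ id])
  show "sym (connectivity d S)"
  proof (rule symI)
    fix x y assume "(x, y) \<in> connectivity d S"
    then obtain p where p: "x \<in> {1..d}" "p \<in> generate (sym_group d) S" "y = p x"
      by (auto simp: connectivity_def)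
    then have "y \<in> {1..d}" "inv' p y = x"
      using permutes_in_image[OF perm[OF p(2)]] permutes_inverses[OF perm[OF p(2)]] by auto
    then show "(y, x) \<in> connectivity d S"
      using generate_inv[OF S p(2)] by (force simp: connectivity_def)
  qed
  show "trans (connectivity d S)"
  proof (rule transI)
    fix x y z assume "(x, y) \<in> connectivity d S" "(y, z) \<in> connectivity d S"
    then obtain p q where "x \<in> {1..d}" "p \<in> generate (sym_group d) S" "q \<in> generate (sym_group d) S"
      "z = (q \<circ> p) x"
      by (auto simp: connectivity_def)
    then show "(x, z) \<in> connectivity d S"
      using generate_comp by (auto simp del: comp_apply simp: connectivity_def)
  qed
qed

lemma transitive_on_iff_connectivity:
  assumes "S \<subseteq> transpositions d"
  shows "transitive_on d (generate (sym_group d) S) \<longleftrightarrow> connectivity d S = {1..d} \<times> {1..d}"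
proof -
  have "connectivity d S \<subseteq> {1..d} \<times> {1..d}"
    using equiv_connectivity[OF assms] by (rule equiv_type)
  moreover have "transitive_on d (generate (sym_group d) S) \<longleftrightarrow> {1..d} \<times> {1..d} \<subseteq> connectivity d S"
    unfolding transitive_on_def connectivity_def by blast
  ultimately show ?thesis
    by blast
qed

text \<open>The orbits refine \<open>R\<close> exactly when every generator moves points within
  classes of \<open>R\<close>. A condition on the generated group thereby becomes a condition on the
  single letters of a word.\<close>

lemma connectivity_subset_iff:
  assumes S: "S \<subseteq> transpositions d" and R: "equiv {1..d} R"
  shows "connectivity d S \<subseteq> R \<longleftrightarrow> S \<subseteq> inner_transpositions R {1..d}"
proof
  assume sub: "connectivity d S \<subseteq> R"
  show "S \<subseteq> inner_transpositions R {1..d}"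
  proof
    fix t assume t: "t \<in> S"
    then obtain a b where ab: "t = transpose a b" "a \<in> {1..d}" "b \<in> {1..d}" "a \<noteq> b"
      using S by (auto simp: transpositions_def)
    have "(a, t a) \<in> connectivity d S"
      using generate.incl[OF t, of "sym_group d"] ab(2) unfolding connectivity_def by blast
    then show "t \<in> inner_transpositions R {1..d}"
      using ab sub by (auto simp: inner_transpositions_def)
  qed
next
  assume sub: "S \<subseteq> inner_transpositions R {1..d}"
  have refl: "(x, x) \<in> R" if "x \<in> {1..d}" for x
    using R that by (auto simp: equiv_def refl_on_def)
  have step: "(x, t x) \<in> R" if x: "x \<in> {1..d}" and t: "t \<in> S" for x t
  proof -
    obtain a b where ab: "t = transpose a b" "(a, b) \<in> R" "(b, a) \<in> R"
      using subsetD[OF sub t] R by (auto simp: inner_transpositions_def equiv_def dest: symD)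
    then show ?thesis
      using refl[OF x] by (auto simp: transpose_def)
  qed
  have "\<forall>x\<in>{1..d}. (x, p x) \<in> R" if "p \<in> generate (sym_group d) S" for p
    using that
  proof induction
    case one
    then show ?case
      using refl by (simp add: sym_group_one)
  next
    case (incl h)
    then show ?case
      using step by blast
  next
    case (inv h)
    then have "h \<in> transpositions d"
      using S by auto
    then have "inv\<^bsub>sym_group d\<^esub> h = h"
      using transpositions_permutes[of h d] by (auto simp: sym_group_carrier transpositions_def)
    then show ?case
      using step inv by simp
  next
    case (eng h1 h2)
    show ?case
    proof
      fix x assume "x \<in> {1..d}"
      then have "(x, h2 x) \<in> R" "(h2 x, h1 (h2 x)) \<in> R"
        using eng permutes_in_image[OF generate_permutes[OF S eng.hyps(2)]] by auto
      then have "(x, h1 (h2 x)) \<in> R"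
        using R by (meson equivE transD)
      then show "(x, (h1 \<otimes>\<^bsub>sym_group d\<^esub> h2) x) \<in> R"
        by (simp add: sym_group_mult)
    qed
  qed
  then show "connectivity d S \<subseteq> R"
    by (auto simp: connectivity_def)
qed

section \<open>Factorizations sorted by their orbit relation\<close>

definition words :: "nat \<Rightarrow> (nat \<Rightarrow> nat) \<Rightarrow> (nat \<times> nat) set \<Rightarrow> nat \<Rightarrow> (nat \<Rightarrow> nat) list set" where
  "words d \<sigma> R r = {ts. set ts \<subseteq> transpositions d \<and> length ts = r \<and> foldr (\<circ>) ts id = \<sigma> \<and>
    connectivity d (set ts) = R}"

lemma finite_words: "finite (words d \<sigma> R r)"
  by (rule finite_subset[OF _ finite_lists_length_eq[OF finite_transpositions[of d], of r]])
    (auto simp: words_def)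

text \<open>The coefficients are independent of \<open>r\<close>. The base \<open>m = 0\<close>
  contributes only at \<open>r = 0\<close>, where \<open>0 ^ 0 = 1\<close>, which is why later
  formulas assume \<open>r > 0\<close>.\<close>

definition power_sum :: "nat \<Rightarrow> (nat \<Rightarrow> int) \<Rightarrow> bool" where
  "power_sum K f \<longleftrightarrow> (\<exists>a. \<forall>r. f r = (\<Sum>m\<in>{- int K..int K}. a m * m ^ r))"

lemma power_sum_diff:
  assumes "power_sum K f" "power_sum K g"
  shows "power_sum K (\<lambda>r. f r - g r)"
proof -
  obtain a b where "\<And>r. f r = (\<Sum>m\<in>{- int K..int K}. a m * m ^ r)"
    "\<And>r. g r = (\<Sum>m\<in>{- int K..int K}. b m * m ^ r)"
    using assms by (auto simp: power_sum_def)
  then show ?thesis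
    unfolding power_sum_def
    by (intro exI[of _ "\<lambda>m. a m - b m"]) (simp add: left_diff_distrib sum_subtractf)
qed

lemma power_sum_zero: "power_sum K (\<lambda>r. 0)"
  unfolding power_sum_def by (intro exI[of _ "\<lambda>m. 0"]) simp

lemma power_sum_sum:
  assumes "\<And>i. i \<in> I \<Longrightarrow> power_sum K (f i)"
  shows "power_sum K (\<lambda>r. \<Sum>i\<in>I. f i r)"
  using assms
proof (induction I rule: infinite_finite_induct)
  case (insert i I)
  \<comment> \<open>Closure under sums is drawn from closure under differences.\<close>
  then have "power_sum K (\<lambda>r. f i r - (0 - (\<Sum>i\<in>I. f i r)))"
    by (intro power_sum_diff power_sum_zero) auto
  then show ?case
    using insert by simp
qed (simp_all add: power_sum_zero)

text \<open>If \<open>\<sigma>\<close> preserves every class of \<open>R\<close>, conjugation by it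
  permutes the inner transpositions and the trace count applies. Otherwise no product of inner
  transpositions equals \<open>\<sigma>\<close> and the count is zero.\<close>

lemma power_sum_words_inside:
  assumes \<sigma>: "\<sigma> permutes {1..d}" and R: "equiv {1..d} R"
  shows "power_sum (d choose 2) (\<lambda>r. fact d *
    int (card {ts. set ts \<subseteq> inner_transpositions R {1..d} \<and> length ts = r \<and> foldr (\<circ>) ts id = \<sigma>}))"
proof (cases "\<forall>x\<in>{1..d}. (x, \<sigma> x) \<in> R")
  case True
  let ?S = "inner_transpositions R {1..d}"
  have RST: "sym R" "trans R"
    using R by (auto simp: equiv_def)
  have "card ?S \<le> card (transpositions d)"
    by (rule card_mono[OF finite_transpositions inner_transpositions_subset])
  then have card: "card ?S \<le> d choose 2"
    using card_transpositions_le le_trans by blast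
  have conj: "f \<circ> t \<circ> inv' f \<in> ?S \<and> inv' f \<circ> t \<circ> f \<in> ?S"
    if t: "t \<in> ?S" and f: "f permutes {1..d}" "\<forall>x\<in>{1..d}. (x, f x) \<in> R" for f t
  proof -
    obtain a b where ab: "t = transpose a b" "a \<in> {1..d}" "b \<in> {1..d}" "a \<noteq> b" "(a, b) \<in> R"
      using t by (auto simp: inner_transpositions_def)
    have g: "transpose (g a) (g b) \<in> ?S" if "g permutes {1..d}" "\<forall>x\<in>{1..d}. (x, g x) \<in> R" for g
    proof -
      have "g a \<in> {1..d}" "g b \<in> {1..d}" "g a \<noteq> g b"
        using permutes_in_image[OF that(1)] permutes_inj[OF that(1)] ab by (auto simp: inj_eq)
      moreover have "(g a, g b) \<in> R"
        using that(2) ab RST by (meson symD transD)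
      ultimately show ?thesis
        by (auto simp: inner_transpositions_def)
    qed
    have "(x, inv' f x) \<in> R" if "x \<in> {1..d}" for x
      using f that permutes_in_image[OF permutes_inv[OF f(1)]] permutes_inverses[OF f(1)] RST(1)
      by (metis symD)
    then show ?thesis
      using g[OF f] g[OF permutes_inv[OF f(1)]] conj_transpose[OF permutes_bij[OF f(1)]]
        conj_inv_transpose[OF permutes_bij[OF f(1)]] ab by simp
  qed
  have "\<exists>a. \<forall>r. fact (card {1..d}) *
      int (card {ts. set ts \<subseteq> ?S \<and> length ts = r \<and> foldr (\<circ>) ts id = \<sigma>}) =
      (\<Sum>m\<in>{- int (d choose 2)..int (d choose 2)}. a m * m ^ r)"
  proof (rule count_products_integer_spectrum)
    show "integer_spectrum (right_op ?S)"
      using RST by (intro integer_spectrum_inner_transpositions) auto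
    show "?S \<subseteq> {p. p permutes {1..d}}"
      using inner_transpositions_subset transpositions_permutes by blast
    show "t \<circ> t = id" if "t \<in> ?S" for t
      using inner_transpositions_subset transpositions_involutive that by blast
  qed (use conj[OF _ \<sigma> True] \<sigma> card in auto)
  then show ?thesis
    by (simp add: power_sum_def)
next
  case False
  have "\<forall>x\<in>{1..d}. (x, foldr (\<circ>) ts id x) \<in> R" if "set ts \<subseteq> inner_transpositions R {1..d}" for ts
    using that
  proof (induction ts)
    case Nil
    then show ?case
      using R by (auto simp: equiv_def refl_on_def)
  next
    case (Cons t ts)
    let ?q = "foldr (\<circ>) ts id"
    have q: "?q permutes {1..d}"
      using Cons.prems inner_transpositions_subset[of R d] transpositions_permutes
      by (intro foldr_comp_permutes) auto
    show ?case
    proof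
      fix x assume "x \<in> {1..d}"
      then have x: "?q x \<in> {1..d}" "(x, ?q x) \<in> R"
        using permutes_in_image[OF q] Cons.IH Cons.prems unfolding set_simps by blast+
      have "(?q x, t (?q x)) \<in> R"
        using Cons.prems R x(1)
        by (auto simp: inner_transpositions_def transpose_def equiv_def refl_on_def dest: symD)
      then show "(x, foldr (\<circ>) (t # ts) id x) \<in> R"
        using x R by (auto simp: equiv_def dest: transD)
    qed
  qed
  then have "{ts. set ts \<subseteq> inner_transpositions R {1..d} \<and> length ts = r \<and> foldr (\<circ>) ts id = \<sigma>} = {}" for r
    using False by auto
  then show ?thesis
    using power_sum_zero by (simp only: card.empty of_nat_0 mult_zero_right)
qed

text \<open>Words with letters inside the classes of \<open>R\<close> split according to their exact
  orbit relation, which is \<open>R\<close> or a strictly finer equivalence. Induction over finer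
  relations subtracts the latter, an inversion over the lattice of equivalence relations.\<close>

theorem power_sum_words:
  assumes \<sigma>: "\<sigma> permutes {1..d}" and "equiv {1..d} R"
  shows "power_sum (d choose 2) (\<lambda>r. fact d * int (card (words d \<sigma> R r)))"
proof -
  have "finite R"
    using equiv_type[OF assms(2)] by (rule finite_subset) simp
  then show ?thesis
    using assms(2)
  proof (induction R rule: finite_psubset_induct)
    case (psubset R)
    define E where "E = {R'. equiv {1..d} R' \<and> R' \<subset> R}"
    have finE: "finite E"
      using psubset.hyps by (rule rev_finite_subset[OF finite_Pow_iff[THEN iffD2]]) (auto simp: E_def)
    let ?inside = "\<lambda>r. {ts. set ts \<subseteq> inner_transpositions R {1..d} \<and> length ts = r \<and> foldr (\<circ>) ts id = \<sigma>}"
    have "?inside r = (\<Union>R'\<in>insert R E. words d \<sigma> R' r)" for r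
    proof -
      have "ts \<in> ?inside r \<longleftrightarrow> (\<exists>R'\<in>insert R E. ts \<in> words d \<sigma> R' r)" for ts
      proof (cases "set ts \<subseteq> transpositions d")
        case True
        have "set ts \<subseteq> inner_transpositions R {1..d} \<longleftrightarrow> connectivity d (set ts) \<in> insert R E"
          using connectivity_subset_iff[OF True psubset.prems] equiv_connectivity[OF True]
          by (auto simp: E_def)
        then show ?thesis
          using True by (auto simp: words_def)
      next
        case False
        then show ?thesis
          using inner_transpositions_subset[of R d] by (auto simp: words_def)
      qed
      then show ?thesis
        by blast
    qed
    then have "card (?inside r) = (\<Sum>R'\<in>insert R E. card (words d \<sigma> R' r))" for r
      using finE finite_words by (simp only:) (rule card_UN_disjoint; auto simp: words_def)
    moreover have "R \<notin> E"
      by (simp add: E_def)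
    ultimately have "int (card (?inside r)) = int (card (words d \<sigma> R r)) + (\<Sum>R'\<in>E. int (card (words d \<sigma> R' r)))" for r
      using finE by simp
    then have eq: "fact d * int (card (words d \<sigma> R r)) =
        fact d * int (card (?inside r)) - (\<Sum>R'\<in>E. fact d * int (card (words d \<sigma> R' r)))" for r
      by (simp add: algebra_simps sum_distrib_left)
    show ?case
      unfolding eq using psubset.IH
      by (intro power_sum_diff power_sum_words_inside[OF \<sigma> psubset.prems] power_sum_sum)
        (auto simp: E_def)
  qed
qed

section \<open>Parity of the number of factors\<close>

lemma sign_foldr_transpositions:
  "set ts \<subseteq> transpositions d \<Longrightarrow> sign (foldr (\<circ>) ts id) = (-1) ^ length ts"
proof (induction ts)
  case Nil
  have "foldr (\<circ>) [] id = (id :: nat \<Rightarrow> nat)"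
    by simp
  then show ?case
    by (simp only: sign_id list.size power_0)
next
  case (Cons t ts)
  have "\<forall>t\<in>set ts. t permutes {1..d}"
    using Cons.prems transpositions_permutes by auto
  then have q: "permutation (foldr (\<circ>) ts id)"
    using foldr_comp_permutes[of ts "{1..d}"] permutation_permutes by blast
  have t: "permutation t" "sign t = -1"
    using Cons.prems by (auto simp: transpositions_def permutation_swap_id sign_swap_id)
  have IH: "sign (foldr (\<circ>) ts id) = (-1) ^ length ts"
    by (rule Cons.IH) (use Cons.prems in simp)
  have "foldr (\<circ>) (t # ts) id = t \<circ> foldr (\<circ>) ts id"
    by simp
  then have "sign (foldr (\<circ>) (t # ts) id) = sign t * sign (foldr (\<circ>) ts id)"
    using sign_compose[OF t(1) q] by (simp only:)
  also have "\<dots> = (-1) ^ length (t # ts)"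
    unfolding IH t(2) by simp
  finally show ?case .
qed

text \<open>Vandermonde independence over the integers. The relation for \<open>Suc j\<close> minus
  \<open>w y\<close> times the relation for \<open>j\<close> eliminates the node \<open>y\<close>
  and multiplies each other coefficient by the nonzero number \<open>w i - w y\<close>.\<close>

lemma power_sums_zero_imp_coeff_zero:
  fixes c w :: "'i \<Rightarrow> int"
  assumes "finite F" "inj_on w F" "\<And>j. (\<Sum>i\<in>F. c i * w i ^ j) = 0"
  shows "\<forall>i\<in>F. c i = 0"
  using assms
proof (induction F arbitrary: c rule: finite_induct)
  case (insert y F)
  have "(\<Sum>i\<in>F. c i * (w i - w y) * w i ^ j) = 0" for j
  proof -
    have "(\<Sum>i\<in>F. c i * (w i - w y) * w i ^ j) = (\<Sum>i\<in>insert y F. c i * (w i - w y) * w i ^ j)"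
      using insert.hyps by simp
    also have "\<dots> = (\<Sum>i\<in>insert y F. c i * w i ^ Suc j) - w y * (\<Sum>i\<in>insert y F. c i * w i ^ j)"
      unfolding sum_distrib_left sum_subtractf[symmetric]
      by (rule sum.cong) (simp_all add: algebra_simps)
    also have "\<dots> = 0"
      using insert.prems(2)[of "Suc j"] insert.prems(2)[of j] by simp
    finally show ?thesis .
  qed
  then have "\<forall>i\<in>F. c i * (w i - w y) = 0"
    using insert.IH[of "\<lambda>i. c i * (w i - w y)"] insert.prems(1) by (simp add: inj_on_insert)
  moreover have "w i \<noteq> w y" if "i \<in> F" for i
    using inj_onD[OF insert.prems(1), of i y] that insert.hyps by auto
  ultimately have "\<forall>i\<in>F. c i = 0"
    by auto
  then show ?case
    using insert.prems(2)[of 0] insert.hyps by simp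
qed simp

text \<open>Pairing \<open>m\<close> with \<open>-m\<close> gives the coefficient
  \<open>a m + (-1)^r a (-m)\<close>. Vanishing for all \<open>r\<close> of the wrong parity forces
  this combination to be zero there, so for the other parity it equals
  \<open>2 * a m\<close>.\<close>

lemma power_sum_parity:
  assumes "power_sum K f" and vanish: "\<And>r. odd (r + r0) \<Longrightarrow> f r = 0"
  shows "\<exists>C. \<forall>r>0. even (r + r0) \<longrightarrow> f r = 2 * (\<Sum>m = 1..K. C m * int m ^ r)"
proof -
  obtain a where a: "\<And>r. f r = (\<Sum>m\<in>{- int K..int K}. a m * m ^ r)"
    using assms(1) by (auto simp: power_sum_def)
  have split: "f r = (\<Sum>m = 1..K. (a (int m) + (-1) ^ r * a (- int m)) * int m ^ r)" if "r > 0" for r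
  proof -
    have eq: "{- int K..int K} = {0} \<union> (int ` {1..K} \<union> (\<lambda>m. - int m) ` {1..K})"
    proof (intro equalityI subsetI)
      fix m assume m: "m \<in> {- int K..int K}"
      consider "m = 0" | "m > 0" | "m < 0"
        by linarith
      then show "m \<in> {0} \<union> (int ` {1..K} \<union> (\<lambda>m. - int m) ` {1..K})"
      proof cases
        case 2
        then have "m = int (nat m)" "nat m \<in> {1..K}"
          using m by auto
        then show ?thesis
          by blast
      next
        case 3
        then have "m = - int (nat (- m))" "nat (- m) \<in> {1..K}"
          using m by auto
        then show ?thesis
          by blast
      qed simp
    qed auto
    have "f r = (\<Sum>m\<in>int ` {1..K} \<union> (\<lambda>m. - int m) ` {1..K}. a m * m ^ r)"
      unfolding a eq using that by (subst sum.union_disjoint) auto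
    also have "\<dots> = (\<Sum>m\<in>int ` {1..K}. a m * m ^ r) + (\<Sum>m\<in>(\<lambda>m. - int m) ` {1..K}. a m * m ^ r)"
      by (rule sum.union_disjoint) auto
    also have "\<dots> = (\<Sum>m = 1..K. a (int m) * int m ^ r) + (\<Sum>m = 1..K. a (- int m) * (- int m) ^ r)"
      by (simp add: sum.reindex inj_on_def)
    also have "\<dots> = (\<Sum>m = 1..K. (a (int m) + (-1) ^ r * a (- int m)) * int m ^ r)"
      unfolding sum.distrib[symmetric]
      by (rule sum.cong) (simp_all add: power_minus[of "int _"] algebra_simps)
    finally show ?thesis .
  qed
  \<comment> \<open>The exponents of the wrong parity used here are \<open>Suc r0 + 2 * j\<close>.
    Splitting off \<open>m ^ Suc r0\<close>, which is nonzero for \<open>m \<ge> 1\<close>, leaves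
    powers of the distinct nodes \<open>m ^ 2\<close>.\<close>
  define c where "c m = (a (int m) - (-1) ^ r0 * a (- int m)) * int m ^ Suc r0" for m
  have "(\<Sum>m = 1..K. c m * (int m ^ 2) ^ j) = 0" for j
  proof -
    have "0 = f (Suc r0 + 2 * j)"
      by (rule vanish[symmetric]) simp
    also have "\<dots> = (\<Sum>m = 1..K. c m * (int m ^ 2) ^ j)"
    proof -
      have "(-1 :: int) ^ (Suc r0 + 2 * j) = - ((-1) ^ r0)"
        "int m ^ (Suc r0 + 2 * j) = int m ^ Suc r0 * (int m ^ 2) ^ j" for m
        by (simp_all add: power_add power_mult)
      then show ?thesis
        by (subst split) (auto simp only: c_def intro!: sum.cong, simp)
    qed
    finally show ?thesis
      by simp
  qed
  moreover have "inj_on (\<lambda>m. int m ^ 2) {1..K}"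
    by (rule inj_onI) (simp add: power2_eq_iff_nonneg)
  ultimately have "\<forall>m\<in>{1..K}. c m = 0"
    by (intro power_sums_zero_imp_coeff_zero) auto
  then have *: "(-1) ^ r0 * a (- int m) = a (int m)" if "m \<in> {1..K}" for m
    using that by (auto simp: c_def)
  have "f r = 2 * (\<Sum>m = 1..K. a (int m) * int m ^ r)" if "r > 0" "even (r + r0)" for r
  proof -
    have "(-1 :: int) ^ r = (-1) ^ r0"
      using that(2) by (auto simp: minus_one_power_iff)
    then have "f r = (\<Sum>m = 1..K. 2 * (a (int m) * int m ^ r))"
      unfolding split[OF that(1)] using * by (intro sum.cong) simp_all
    then show ?thesis
      by (simp add: sum_distrib_left)
  qed
  then show ?thesis
    by (intro exI[of _ "\<lambda>m. a (int m)"]) simp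
qed

text \<open>The sign of \<open>\<sigma>\<close> determines the parity of the number of
  factors.\<close>

lemma card_words_parity:
  assumes "odd (r + r')" "words d \<sigma> R r' \<noteq> {}"
  shows "card (words d \<sigma> R r) = 0"
proof -
  have "sign \<sigma> = (-1) ^ r" if "ts \<in> words d \<sigma> R r" for ts r
    using that sign_foldr_transpositions[of ts d] by (auto simp: words_def)
  moreover have "(-1 :: int) ^ r \<noteq> (-1) ^ r'"
    using assms(1) by (auto simp: minus_one_power_iff)
  ultimately have "words d \<sigma> R r = {}"
    using assms(2) by (metis ex_in_conv)
  then show ?thesis
    by simp
qed

text \<open>One factorization whose length has the parity of \<open>r0\<close> rules out all lengths
  of the other parity. If there is none, zero coefficients work.\<close>

lemma card_words_formula:
  assumes "\<sigma> permutes {1..d}" "equiv {1..d} R"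
  shows "\<exists>C. \<forall>r>0. even (r + r0) \<longrightarrow>
    fact d * int (card (words d \<sigma> R r)) = 2 * (\<Sum>m = 1..d choose 2. C m * int m ^ r)"
proof (cases "\<exists>r'. even (r' + r0) \<and> words d \<sigma> R r' \<noteq> {}")
  case True
  then obtain r' where r': "even (r' + r0)" "words d \<sigma> R r' \<noteq> {}"
    by blast
  show ?thesis
  proof (rule power_sum_parity[OF power_sum_words[OF assms]])
    fix r assume "odd (r + r0)"
    then have "odd (r + r')"
      using r' by auto
    then show "fact d * int (card (words d \<sigma> R r)) = 0"
      using card_words_parity[OF _ r'(2)] by simp
  qed
next
  case False
  then show ?thesis
    by (intro exI[of _ "\<lambda>_. 0"]) auto
qed

section \<open>Conjugating permutations of a given cycle type\<close>

lemma card_listset: "card (listset As) = prod_list (map card As)"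
proof (induction As)
  case (Cons A As)
  have "listset (A # As) = (\<lambda>(x, xs). x # xs) ` (A \<times> listset As)"
    by (auto simp: set_Cons_def)
  then have "card (listset (A # As)) = card (A \<times> listset As)"
    by (simp only:) (rule card_image, auto simp: inj_on_def)
  then show ?case
    by (simp add: card_cartesian_product Cons)
qed simp

text \<open>Once one ordering \<open>os0\<close> with values \<open>\<mu>\<close> is fixed, every
  other one arises from a unique permutation of positions, and this permutation must preserve
  \<open>\<mu>\<close>.\<close>

lemma card_orderings_tuple_aut:
  assumes fin: "finite Q" and ms: "image_mset f (mset_set Q) = mset \<mu>"
  shows "card {os. distinct os \<and> set os = Q \<and> map f os = \<mu>} = card (tuple_aut \<mu>)"
proof -
  obtain os1 where os1: "set os1 = Q" "distinct os1"
    using finite_distinct_list[OF fin] by blast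
  then have "mset (map f os1) = mset \<mu>"
    using ms mset_set_set[of os1] by simp
  then obtain p where p: "p permutes {..<length (map f os1)}" "permute_list p (map f os1) = \<mu>"
    using mset_eq_permutation[of \<mu> "map f os1"] by metis
  define os0 where "os0 = permute_list p os1"
  have os0: "set os0 = Q" "distinct os0" "map f os0 = \<mu>"
    using p os1 by (simp_all add: os0_def permute_list_map)
  then have len: "length os0 = length \<mu>"
    by auto
  have "bij_betw (\<lambda>\<pi>. permute_list \<pi> os0) (tuple_aut \<mu>) {os. distinct os \<and> set os = Q \<and> map f os = \<mu>}"
  proof (rule bij_betw_imageI)
    show "inj_on (\<lambda>\<pi>. permute_list \<pi> os0) (tuple_aut \<mu>)"
    proof (rule inj_onI)
      fix \<pi> \<rho> assume "\<pi> \<in> tuple_aut \<mu>" "\<rho> \<in> tuple_aut \<mu>"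
        and eq: "permute_list \<pi> os0 = permute_list \<rho> os0"
      then have perm: "\<pi> permutes {..<length os0}" "\<rho> permutes {..<length os0}"
        by (simp_all add: tuple_aut_def len)
      show "\<pi> = \<rho>"
      proof
        fix i
        show "\<pi> i = \<rho> i"
        proof (cases "i < length os0")
          case True
          then have "os0 ! \<pi> i = os0 ! \<rho> i"
            using permute_list_nth[OF perm(1)] permute_list_nth[OF perm(2)] eq by metis
          moreover have "\<pi> i < length os0" "\<rho> i < length os0"
            using True permutes_in_image[OF perm(1)] permutes_in_image[OF perm(2)] by auto
          ultimately show ?thesis
            using os0(2) by (simp add: nth_eq_iff_index_eq)
        next
          case False
          then show ?thesis
            using permutes_not_in[OF perm(1)] permutes_not_in[OF perm(2)] by simp
        qed
      qed
    qed
    show "(\<lambda>\<pi>. permute_list \<pi> os0) ` tuple_aut \<mu> = {os. distinct os \<and> set os = Q \<and> map f os = \<mu>}"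
    proof (intro equalityI subsetI)
      fix os assume "os \<in> (\<lambda>\<pi>. permute_list \<pi> os0) ` tuple_aut \<mu>"
      then obtain \<pi> where \<pi>: "os = permute_list \<pi> os0" "\<pi> permutes {..<length os0}" "permute_list \<pi> \<mu> = \<mu>"
        by (auto simp: tuple_aut_def len)
      then show "os \<in> {os. distinct os \<and> set os = Q \<and> map f os = \<mu>}"
        using os0 permute_list_map[OF \<pi>(2), of f] by simp
    next
      fix os assume "os \<in> {os. distinct os \<and> set os = Q \<and> map f os = \<mu>}"
      then have os: "distinct os" "set os = Q" "map f os = \<mu>"
        by auto
      then have "mset os = mset os0"
        using os0 by (simp flip: set_eq_iff_mset_eq_distinct)
      then obtain \<pi> where \<pi>: "\<pi> permutes {..<length os0}" "permute_list \<pi> os0 = os"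
        by (rule mset_eq_permutation)
      then have "permute_list \<pi> \<mu> = \<mu>"
        using permute_list_map[OF \<pi>(1), of f] os0 os by simp
      then show "os \<in> (\<lambda>\<pi>. permute_list \<pi> os0) ` tuple_aut \<mu>"
        using \<pi> by (auto simp: tuple_aut_def len)
    qed
  qed
  then show ?thesis
    by (simp add: bij_betw_same_card)
qed

text \<open>The first return time to \<open>x\<close> is the size of its orbit. This makes the map
  \<open>f^k y\<close> to \<open>g^k x\<close> well defined between orbits of equal size.\<close>

lemma funpow_eq_iff_mod_card_orbit:
  assumes "permutation f"
  shows "(f ^^ j) x = (f ^^ k) x \<longleftrightarrow> j mod card (Orbits.orbit f x) = k mod card (Orbits.orbit f x)"
proof -
  let ?n = "funpow_dist1 f x x"
  have x: "x \<in> Orbits.orbit f x"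
    by (rule permutation_self_in_orbit[OF assms])
  have inj: "inj_on (\<lambda>n. (f ^^ n) x) {0..<?n}"
    by (rule inj_on_funpow_dist1[OF x])
  have card: "card (Orbits.orbit f x) = ?n"
    using orbit_conv_funpow_dist1[OF x] card_image[OF inj] by simp
  have mod: "(f ^^ (i mod ?n)) x = (f ^^ i) x" for i
    by (rule funpow_mod_eq[OF funpow_dist1_prop[OF x]])
  have "(f ^^ j) x = (f ^^ k) x \<longleftrightarrow> (f ^^ (j mod ?n)) x = (f ^^ (k mod ?n)) x"
    by (simp only: mod)
  also have "\<dots> \<longleftrightarrow> j mod ?n = k mod ?n"
    using inj_on_eq_iff[OF inj, of "j mod ?n" "k mod ?n"] by simp
  finally show ?thesis
    unfolding card .
qed

lemma orbit_eq_if_mem: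
  assumes "permutation f" "y \<in> Orbits.orbit f x"
  shows "Orbits.orbit f y = Orbits.orbit f x"
  using orbit_cyclic_eq3[OF cyclic_on_orbit'[OF assms(1)] assms(2)] .

lemma funpow_intertwine:
  assumes "\<psi> \<circ> f = g \<circ> \<psi>"
  shows "\<psi> ((f ^^ k) x) = (g ^^ k) (\<psi> x)"
proof (induction k)
  case (Suc k)
  have "\<psi> (f y) = g (\<psi> y)" for y
    using fun_cong[OF assms, of y] by simp
  then show ?case
    using Suc by simp
qed simp

lemma orbit_intertwine:
  assumes "\<psi> \<circ> f = g \<circ> \<psi>"
  shows "Orbits.orbit g (\<psi> x) = \<psi> ` Orbits.orbit f x"
  unfolding orbit_altdef by (auto simp: funpow_intertwine[OF assms, symmetric])

section \<open>Cycles with marked points, and intertwining permutations\<close>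

definition orbit_lists :: "'a set \<Rightarrow> ('a \<Rightarrow> 'a) \<Rightarrow> nat list \<Rightarrow> 'a set list set" where
  "orbit_lists B f \<mu> = {os. distinct os \<and> set os = Orbits.orbit f ` B \<and> map card os = \<mu>}"

text \<open>An assignment of the cycles of \<open>f\<close> to the positions of \<open>\<mu>\<close>
  together with a marked point on each cycle. These data rigidify the cycle structure.\<close>

definition base_lists :: "'a set \<Rightarrow> ('a \<Rightarrow> 'a) \<Rightarrow> nat list \<Rightarrow> 'a list set" where
  "base_lists B f \<mu> = {xs. set xs \<subseteq> B \<and> map (Orbits.orbit f) xs \<in> orbit_lists B f \<mu>}"

lemma base_listsD:
  assumes "xs \<in> base_lists B f \<mu>"
  shows "set xs \<subseteq> B" "Orbits.orbit f ` set xs = Orbits.orbit f ` B" "length xs = length \<mu>"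
    "map (card \<circ> Orbits.orbit f) xs = \<mu>"
proof -
  have *: "set xs \<subseteq> B" "set (map (Orbits.orbit f) xs) = Orbits.orbit f ` B"
    "map card (map (Orbits.orbit f) xs) = \<mu>"
    using assms by (simp_all only: base_lists_def orbit_lists_def mem_Collect_eq)
  then show "set xs \<subseteq> B" "Orbits.orbit f ` set xs = Orbits.orbit f ` B"
    "map (card \<circ> Orbits.orbit f) xs = \<mu>"
    by simp_all
  then show "length xs = length \<mu>"
    by auto
qed

text \<open>There are \<open>card (tuple_aut \<mu>)\<close> ways to order the cycles, and each
  ordering allows \<open>prod_list \<mu>\<close> choices of marked points.\<close>

lemma card_base_lists:
  assumes B: "finite B" and f: "f permutes B"
    and type: "image_mset card (mset_set (Orbits.orbit f ` B)) = mset \<mu>"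
  shows "card (base_lists B f \<mu>) = card (tuple_aut \<mu>) * prod_list \<mu>"
proof -
  have perm: "permutation f"
    using B f permutation_permutes by blast
  have listset_iff: "xs \<in> listset os \<longleftrightarrow> set xs \<subseteq> B \<and> map (Orbits.orbit f) xs = os"
    if "set os \<subseteq> Orbits.orbit f ` B" for xs os
    using that
  proof (induction os arbitrary: xs)
    case (Cons A os)
    then obtain b where b: "A = Orbits.orbit f b" "b \<in> B"
      by auto
    have "x \<in> A \<longleftrightarrow> x \<in> B \<and> Orbits.orbit f x = A" for x
      using orbit_eq_if_mem[OF perm] permutation_self_in_orbit[OF perm] permutes_orbit_subset[OF f b(2)] b
      by auto
    then show ?case
      using Cons by (cases xs) (auto simp: set_Cons_def)
  qed auto
  then have listset_iff: "xs \<in> listset os \<longleftrightarrow> set xs \<subseteq> B \<and> map (Orbits.orbit f) xs = os"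
    if "os \<in> orbit_lists B f \<mu>" for xs os
    using that by (simp add: orbit_lists_def)
  have "base_lists B f \<mu> = (\<Union>os\<in>orbit_lists B f \<mu>. listset os)"
  proof (intro equalityI subsetI)
    fix xs assume "xs \<in> base_lists B f \<mu>"
    then have "xs \<in> listset (map (Orbits.orbit f) xs)" "map (Orbits.orbit f) xs \<in> orbit_lists B f \<mu>"
      using listset_iff by (simp_all add: base_lists_def)
    then show "xs \<in> (\<Union>os\<in>orbit_lists B f \<mu>. listset os)"
      by blast
  next
    fix xs assume "xs \<in> (\<Union>os\<in>orbit_lists B f \<mu>. listset os)"
    then obtain os where os: "os \<in> orbit_lists B f \<mu>" "xs \<in> listset os"
      by blast
    then show "xs \<in> base_lists B f \<mu>"
      using listset_iff[OF os(1), of xs] by (simp add: base_lists_def)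
  qed
  moreover have "card (\<Union>os\<in>orbit_lists B f \<mu>. listset os) = (\<Sum>os\<in>orbit_lists B f \<mu>. card (listset os))"
  proof (rule card_UN_disjoint)
    show "finite (orbit_lists B f \<mu>)"
      by (rule finite_subset[OF _ finite_lists_length_eq[of "Orbits.orbit f ` B" "length \<mu>"]])
        (use B in \<open>auto simp only: orbit_lists_def length_map finite_imageI order_refl\<close>)
    show "\<forall>os\<in>orbit_lists B f \<mu>. finite (listset os)"
    proof
      fix os assume os: "os \<in> orbit_lists B f \<mu>"
      then have "listset os \<subseteq> {xs. set xs \<subseteq> B \<and> length xs = length os}"
        using listset_iff[OF os] by auto
      then show "finite (listset os)"
        using finite_lists_length_eq[OF B] by (rule finite_subset)
    qed
    show "\<forall>os\<in>orbit_lists B f \<mu>. \<forall>os'\<in>orbit_lists B f \<mu>. os \<noteq> os' \<longrightarrow> listset os \<inter> listset os' = {}"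
      by (auto simp: listset_iff)
  qed
  moreover have "card (listset os) = prod_list \<mu>" if "os \<in> orbit_lists B f \<mu>" for os
    using that by (auto simp: card_listset orbit_lists_def)
  moreover have "card (orbit_lists B f \<mu>) = card (tuple_aut \<mu>)"
    unfolding orbit_lists_def by (rule card_orderings_tuple_aut) (use B type in auto)
  ultimately show ?thesis
    by simp
qed

text \<open>The intertwining relation forces \<open>f^k (ys ! i)\<close> to go to
  \<open>g^k (xs ! i)\<close>; equality of orbit sizes makes this consistent.\<close>

lemma ex_intertwiner:
  assumes B: "finite B" and f: "f permutes B" and g: "g permutes B"
    and ys: "ys \<in> base_lists B f \<mu>" and xs: "xs \<in> base_lists B g \<mu>"
  shows "\<exists>\<psi>. \<psi> permutes B \<and> \<psi> \<circ> f = g \<circ> \<psi> \<and> map \<psi> ys = xs"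
proof -
  have perm: "permutation f" "permutation g"
    using B f g permutation_permutes by blast+
  let ?n = "length \<mu>"
  have len: "length ys = ?n" "length xs = ?n"
    using base_listsD(3) xs ys by blast+
  have cards: "card (Orbits.orbit f (ys ! i)) = card (Orbits.orbit g (xs ! i))" if "i < ?n" for i
    using arg_cong[OF base_listsD(4)[OF xs], of "\<lambda>l. l ! i"] arg_cong[OF base_listsD(4)[OF ys], of "\<lambda>l. l ! i"]
      that len by simp
  have mem: "ys ! i \<in> B" "xs ! i \<in> B" if "i < ?n" for i
    using base_listsD(1)[OF xs] base_listsD(1)[OF ys] that len by (auto simp: subset_iff)
  have reach: "\<exists>i k. i < ?n \<and> b = (h ^^ k) (zs ! i)"
    if zs: "zs \<in> base_lists B h \<mu>" and h: "permutation h" and b: "b \<in> B" for zs h b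
  proof -
    have "Orbits.orbit h b \<in> Orbits.orbit h ` set zs"
      using base_listsD(2)[OF zs] b by blast
    then obtain z where z: "z \<in> set zs" "Orbits.orbit h b = Orbits.orbit h z"
      by blast
    then have "b \<in> Orbits.orbit h z"
      using permutation_self_in_orbit[OF h, of b] by simp
    then obtain k where "b = (h ^^ k) z"
      by (auto simp: orbit_altdef)
    then show ?thesis
      using z base_listsD(3)[OF zs] by (metis in_set_conv_nth)
  qed
  have unique: "i = j" if ij: "i < ?n" "j < ?n" "(f ^^ k) (ys ! i) = (f ^^ l) (ys ! j)" for i j k l
  proof -
    have "Orbits.orbit f ((f ^^ k) y) = Orbits.orbit f y" for k y
      by (rule orbit_eq_if_mem[OF perm(1)]) (rule funpow_in_orbit[OF permutation_self_in_orbit[OF perm(1)]])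
    then have "Orbits.orbit f (ys ! i) = Orbits.orbit f (ys ! j)"
      using ij(3) by metis
    moreover have "distinct (map (Orbits.orbit f) ys)"
      using ys by (simp add: base_lists_def orbit_lists_def)
    ultimately show ?thesis
      using ij len nth_eq_iff_index_eq[of "map (Orbits.orbit f) ys" i j] by simp
  qed
  \<comment> \<open>\<open>K b\<close> is an arbitrary choice among exponents that agree modulo the
    orbit size; the fact about \<open>\<psi>\<close> below shows that the choice does not
    matter.\<close>
  obtain I K where IK: "\<And>b. b \<in> B \<Longrightarrow> I b < ?n" "\<And>b. b \<in> B \<Longrightarrow> b = (f ^^ K b) (ys ! I b)"
    using reach[OF ys perm(1)] by metis
  define \<psi> where "\<psi> b = (if b \<in> B then (g ^^ K b) (xs ! I b) else b)" for b
  have in_B: "(f ^^ k) (ys ! i) \<in> B" "(g ^^ k) (xs ! i) \<in> B" if "i < ?n" for i k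
    using mem[OF that] permutes_in_image[OF permutes_funpow[OF f]] permutes_in_image[OF permutes_funpow[OF g]]
    by blast+
  have \<psi>: "\<psi> ((f ^^ k) (ys ! i)) = (g ^^ k) (xs ! i)" if i: "i < ?n" for i k
  proof -
    let ?b = "(f ^^ k) (ys ! i)"
    have b: "?b = (f ^^ K ?b) (ys ! I ?b)"
      using IK(2)[OF in_B(1)[OF i]] .
    then have I: "I ?b = i"
      using unique[OF i IK(1)[OF in_B(1)[OF i]]] by metis
    then have "(f ^^ k) (ys ! i) = (f ^^ K ?b) (ys ! i)"
      using b by simp
    then have "(g ^^ k) (xs ! i) = (g ^^ K ?b) (xs ! i)"
      unfolding funpow_eq_iff_mod_card_orbit[OF perm(1)] funpow_eq_iff_mod_card_orbit[OF perm(2)] cards[OF i] .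
    then show ?thesis
      using in_B(1)[OF i] I by (simp add: \<psi>_def)
  qed
  have "B \<subseteq> \<psi> ` B"
  proof
    fix b assume "b \<in> B"
    then obtain i k where "i < ?n" "b = (g ^^ k) (xs ! i)"
      using reach[OF xs perm(2)] by blast
    then show "b \<in> \<psi> ` B"
      using \<psi> in_B(1) by (metis imageI)
  qed
  moreover have "\<psi> ` B \<subseteq> B"
    using in_B(2)[OF IK(1)] by (auto simp: \<psi>_def)
  ultimately have img: "\<psi> ` B = B"
    by blast
  then have "bij_betw \<psi> B B"
    using eq_card_imp_inj_on[OF B, of \<psi>] by (simp add: bij_betw_def)
  then have "\<psi> permutes B"
    by (rule bij_imp_permutes) (simp add: \<psi>_def)
  moreover have "\<psi> \<circ> f = g \<circ> \<psi>"
  proof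
    fix b
    show "(\<psi> \<circ> f) b = (g \<circ> \<psi>) b"
    proof (cases "b \<in> B")
      case True
      then obtain i k where ik: "i < ?n" "b = (f ^^ k) (ys ! i)"
        using reach[OF ys perm(1)] by blast
      then show ?thesis
        using \<psi>[OF ik(1), of "Suc k"] \<psi>[OF ik(1), of k] by simp
    next
      case False
      then show ?thesis
        using permutes_not_in[OF f False] permutes_not_in[OF g False] by (simp add: \<psi>_def)
    qed
  qed
  moreover have "map \<psi> ys = xs"
    using \<psi>[of _ 0] len by (intro nth_equalityI) auto
  ultimately show ?thesis
    by blast
qed

lemma orbit_image_intertwine:
  assumes "\<psi> permutes B" "\<psi> \<circ> f = g \<circ> \<psi>"
  shows "Orbits.orbit g ` B = (`) \<psi> ` Orbits.orbit f ` B"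
proof -
  have "Orbits.orbit g ` B = Orbits.orbit g ` \<psi> ` B"
    by (simp add: permutes_image[OF assms(1)])
  then show ?thesis
    by (simp add: image_image orbit_intertwine[OF assms(2)])
qed

text \<open>An intertwiner is determined by the images of the marked points \<open>ys\<close> of
  \<open>f\<close>, and by \<open>ex_intertwiner\<close> any base list of \<open>g\<close> can occur
  as their image. For \<open>f = g\<close> this is the order of the centralizer.\<close>

theorem card_intertwiners:
  assumes B: "finite B" and f: "f permutes B" and g: "g permutes B"
    and typef: "image_mset card (mset_set (Orbits.orbit f ` B)) = mset \<mu>"
    and typeg: "image_mset card (mset_set (Orbits.orbit g ` B)) = mset \<mu>"
    and pos: "\<forall>k\<in>set \<mu>. 0 < k"
  shows "card {\<psi>. \<psi> permutes B \<and> \<psi> \<circ> f = g \<circ> \<psi>} = card (tuple_aut \<mu>) * prod_list \<mu>"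
proof -
  have "finite (tuple_aut \<mu>)"
    by (rule finite_subset[OF _ finite_permutations[of "{..<length \<mu>}"]]) (auto simp: tuple_aut_def)
  moreover have "id \<in> tuple_aut \<mu>"
    by (simp add: tuple_aut_def permutes_id)
  moreover have "prod_list \<mu> > 0"
    using pos by (induction \<mu>) auto
  \<comment> \<open>Positivity of the count supplies the reference list \<open>ys\<close>.\<close>
  ultimately have "card (base_lists B f \<mu>) > 0"
    unfolding card_base_lists[OF B f typef] by (auto simp: card_gt_0_iff)
  then obtain ys where ys: "ys \<in> base_lists B f \<mu>"
    by (auto simp: card_gt_0_iff)
  have perm: "permutation f"
    using B f permutation_permutes by blast
  have "bij_betw (\<lambda>\<psi>. map \<psi> ys) {\<psi>. \<psi> permutes B \<and> \<psi> \<circ> f = g \<circ> \<psi>} (base_lists B g \<mu>)"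
  proof (rule bij_betw_imageI)
    show "inj_on (\<lambda>\<psi>. map \<psi> ys) {\<psi>. \<psi> permutes B \<and> \<psi> \<circ> f = g \<circ> \<psi>}"
    proof (rule inj_onI, elim CollectE conjE)
      fix \<psi> \<phi> assume \<psi>: "\<psi> permutes B" "\<psi> \<circ> f = g \<circ> \<psi>" and \<phi>: "\<phi> permutes B" "\<phi> \<circ> f = g \<circ> \<phi>"
        and eq: "map \<psi> ys = map \<phi> ys"
      show "\<psi> = \<phi>"
      proof
        fix b
        show "\<psi> b = \<phi> b"
        proof (cases "b \<in> B")
          case True
          then obtain y where y: "y \<in> set ys" "Orbits.orbit f b = Orbits.orbit f y"
            using base_listsD(2)[OF ys] by (metis imageE imageI)
          then have "b \<in> Orbits.orbit f y"
            using permutation_self_in_orbit[OF perm, of b] by simp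
          then obtain k where "b = (f ^^ k) y"
            by (auto simp: orbit_altdef)
          moreover have "\<psi> y = \<phi> y"
            using eq y by simp
          ultimately show ?thesis
            by (simp add: funpow_intertwine[OF \<psi>(2)] funpow_intertwine[OF \<phi>(2)])
        next
          case False
          then show ?thesis
            using \<psi>(1) \<phi>(1) by (simp add: permutes_not_in)
        qed
      qed
    qed
    show "(\<lambda>\<psi>. map \<psi> ys) ` {\<psi>. \<psi> permutes B \<and> \<psi> \<circ> f = g \<circ> \<psi>} = base_lists B g \<mu>"
    proof (intro equalityI subsetI)
      fix xs assume "xs \<in> (\<lambda>\<psi>. map \<psi> ys) ` {\<psi>. \<psi> permutes B \<and> \<psi> \<circ> f = g \<circ> \<psi>}"
      then obtain \<psi> where \<psi>: "\<psi> permutes B" "\<psi> \<circ> f = g \<circ> \<psi>" "xs = map \<psi> ys"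
        by auto
      have inj: "inj \<psi>"
        by (rule permutes_inj[OF \<psi>(1)])
      have map: "map (Orbits.orbit g) xs = map ((`) \<psi>) (map (Orbits.orbit f) ys)"
        by (simp add: \<psi>(3) orbit_intertwine[OF \<psi>(2)])
      have os: "distinct (map (Orbits.orbit f) ys)" "set (map (Orbits.orbit f) ys) = Orbits.orbit f ` B"
        "map card (map (Orbits.orbit f) ys) = \<mu>" "set ys \<subseteq> B"
        using ys by (simp_all only: base_lists_def orbit_lists_def mem_Collect_eq)
      have "inj ((`) \<psi>)"
        using inj by (simp add: inj_image_eq_iff inj_def)
      then have "distinct (map (Orbits.orbit g) xs)"
        unfolding map using os(1) inj_on_subset[OF _ subset_UNIV]
        by (subst distinct_map) blast
      moreover have "set (map (Orbits.orbit g) xs) = Orbits.orbit g ` B"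
        unfolding map set_map[of "(`) \<psi>"] os(2) orbit_image_intertwine[OF \<psi>(1,2)] ..
      moreover have "map card (map (Orbits.orbit g) xs) = \<mu>"
        unfolding map os(3)[symmetric] using card_image[OF inj_on_subset[OF inj]] by simp
      moreover have "set xs \<subseteq> B"
        using os(4) permutes_in_image[OF \<psi>(1)] by (auto simp: \<psi>(3))
      ultimately show "xs \<in> base_lists B g \<mu>"
        by (simp only: base_lists_def orbit_lists_def mem_Collect_eq)
    next
      fix xs assume "xs \<in> base_lists B g \<mu>"
      then obtain \<psi> where "\<psi> permutes B" "\<psi> \<circ> f = g \<circ> \<psi>" "map \<psi> ys = xs"
        using ex_intertwiner[OF B f g ys] by blast
      then show "xs \<in> (\<lambda>\<psi>. map \<psi> ys) ` {\<psi>. \<psi> permutes B \<and> \<psi> \<circ> f = g \<circ> \<psi>}"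
        by blast
    qed
  qed
  then show ?thesis
    using card_base_lists[OF B g typeg] by (simp add: bij_betw_same_card)
qed

lemma cycle_type_intertwine:
  assumes "\<psi> permutes {1..d}" "\<psi> \<circ> f = g \<circ> \<psi>"
  shows "cycle_type d g = cycle_type d f"
proof -
  have inj: "inj \<psi>"
    by (rule permutes_inj[OF assms(1)])
  have "inj ((`) \<psi>)"
    using inj by (simp add: inj_image_eq_iff inj_def)
  then have "mset_set (Orbits.orbit g ` {1..d}) = image_mset ((`) \<psi>) (mset_set (Orbits.orbit f ` {1..d}))"
    unfolding orbit_image_intertwine[OF assms]
    by (intro image_mset_mset_set[symmetric]) (rule inj_on_subset, auto)
  moreover have "card (\<psi> ` A) = card A" for A
    by (rule card_image[OF inj_on_subset[OF inj]]) simp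
  ultimately show ?thesis
    by (simp add: cycle_type_def image_mset.compositionality comp_def)
qed

section \<open>Hurwitz numbers\<close>

lemma conj_transpositions:
  assumes \<psi>: "\<psi> permutes {1..d}" and t: "t \<in> transpositions d"
  shows "\<psi> \<circ> t \<circ> inv' \<psi> \<in> transpositions d"
proof -
  obtain a b where ab: "t = transpose a b" "a \<in> {1..d}" "b \<in> {1..d}" "a \<noteq> b"
    using t by (auto simp: transpositions_def)
  then have "\<psi> a \<in> {1..d}" "\<psi> b \<in> {1..d}" "\<psi> a \<noteq> \<psi> b"
    using permutes_in_image[OF \<psi>] permutes_inj[OF \<psi>] by (simp_all only: inj_eq not_False_eq_True)
  then show ?thesis
    unfolding ab(1) conj_transpose[OF permutes_bij[OF \<psi>]] transpositions_def by blast
qed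

lemma conj_generate:
  assumes \<psi>: "\<psi> permutes {1..d}" and S: "S \<subseteq> transpositions d" and "p \<in> generate (sym_group d) S"
  shows "\<psi> \<circ> p \<circ> inv' \<psi> \<in> generate (sym_group d) ((\<lambda>t. \<psi> \<circ> t \<circ> inv' \<psi>) ` S)"
  using assms(3)
proof induction
  case one
  have "\<psi> \<circ> \<one>\<^bsub>sym_group d\<^esub> \<circ> inv' \<psi> = \<one>\<^bsub>sym_group d\<^esub>"
    by (simp add: sym_group_one permutes_inv_o[OF \<psi>])
  then show ?case
    by (simp only: generate.one)
next
  case (incl h)
  then show ?case
    by (intro generate.incl imageI)
next
  case (inv h)
  then have "h \<in> transpositions d"
    using S by blast
  then have "inv\<^bsub>sym_group d\<^esub> h = h"
    using transpositions_permutes[of h d] by (auto simp: sym_group_carrier transpositions_def)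
  then show ?case
    using inv by (simp only:) (intro generate.incl imageI)
next
  case (eng h1 h2)
  have "\<psi> \<circ> (h1 \<circ> h2) \<circ> inv' \<psi> = (\<psi> \<circ> h1 \<circ> inv' \<psi>) \<circ> (\<psi> \<circ> h2 \<circ> inv' \<psi>)"
    by (simp add: fun_eq_iff permutes_inverses[OF \<psi>])
  then show ?case
    using generate_comp[OF eng.IH] by (simp only: sym_group_mult)
qed

lemma foldr_comp_conj:
  assumes "\<psi> permutes B"
  shows "foldr (\<circ>) (map (\<lambda>t. \<psi> \<circ> t \<circ> inv' \<psi>) ts) id = \<psi> \<circ> foldr (\<circ>) ts id \<circ> inv' \<psi>"
proof (induction ts)
  case Nil
  show ?case
    by (simp add: permutes_inv_o[OF assms])
next
  case (Cons t ts)
  have "foldr (\<circ>) (map (\<lambda>t. \<psi> \<circ> t \<circ> inv' \<psi>) (t # ts)) id =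
      (\<psi> \<circ> t \<circ> inv' \<psi>) \<circ> (\<psi> \<circ> foldr (\<circ>) ts id \<circ> inv' \<psi>)"
    unfolding Cons.IH[symmetric] by simp
  also have "\<dots> = \<psi> \<circ> foldr (\<circ>) (t # ts) id \<circ> inv' \<psi>"
    by (simp add: fun_eq_iff permutes_inverses[OF assms])
  finally show ?case .
qed

text \<open>Conjugating every letter by \<open>\<psi>\<close> is injective on words, conjugates the
  product and preserves transitivity.\<close>

lemma card_words_intertwine_le:
  assumes \<psi>: "\<psi> permutes {1..d}" and fg: "\<psi> \<circ> f = g \<circ> \<psi>"
  shows "card (words d f ({1..d} \<times> {1..d}) r) \<le> card (words d g ({1..d} \<times> {1..d}) r)"
proof (rule card_inj_on_le)
  let ?c = "\<lambda>t. \<psi> \<circ> t \<circ> inv' \<psi>"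
  have "inv' \<psi> \<circ> ?c t \<circ> \<psi> = t" for t
    by (simp add: fun_eq_iff permutes_inverses[OF \<psi>])
  then have "inj ?c"
    by (rule inj_on_inverseI[where g = "\<lambda>t. inv' \<psi> \<circ> t \<circ> \<psi>"])
  then show "inj_on (map ?c) (words d f ({1..d} \<times> {1..d}) r)"
    by (rule inj_on_subset[OF inj_mapI subset_UNIV])
  show "finite (words d g ({1..d} \<times> {1..d}) r)"
    by (rule finite_words)
  show "map ?c ` words d f ({1..d} \<times> {1..d}) r \<subseteq> words d g ({1..d} \<times> {1..d}) r"
  proof (rule image_subsetI)
    fix ts assume "ts \<in> words d f ({1..d} \<times> {1..d}) r"
    then have ts: "set ts \<subseteq> transpositions d" "length ts = r" "foldr (\<circ>) ts id = f"
      and tr: "transitive_on d (generate (sym_group d) (set ts))"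
      by (auto simp only: words_def mem_Collect_eq transitive_on_iff_connectivity)
    have sub: "?c ` set ts \<subseteq> transpositions d"
      using conj_transpositions[OF \<psi>] ts(1) by blast
    have "foldr (\<circ>) (map ?c ts) id = g \<circ> (\<psi> \<circ> inv' \<psi>)"
      unfolding foldr_comp_conj[OF \<psi>] ts(3) fg by (simp only: comp_assoc)
    then have "foldr (\<circ>) (map ?c ts) id = g"
      by (simp add: permutes_inv_o[OF \<psi>])
    moreover have "transitive_on d (generate (sym_group d) (?c ` set ts))"
      unfolding transitive_on_def
    proof (intro ballI)
      fix x y assume "x \<in> {1..d}" "y \<in> {1..d}"
      then have "inv' \<psi> x \<in> {1..d}" "inv' \<psi> y \<in> {1..d}"
        by (simp_all only: permutes_in_image[OF permutes_inv[OF \<psi>]])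
      then obtain p where p: "p \<in> generate (sym_group d) (set ts)" "p (inv' \<psi> x) = inv' \<psi> y"
        using tr unfolding transitive_on_def by blast
      then have "?c p x = y"
        by (simp add: permutes_inverses[OF \<psi>])
      then show "\<exists>p\<in>generate (sym_group d) (?c ` set ts). p x = y"
        using conj_generate[OF \<psi> ts(1) p(1)] by blast
    qed
    ultimately show "map ?c ts \<in> words d g ({1..d} \<times> {1..d}) r"
      using sub ts(2) transitive_on_iff_connectivity[OF sub] by (simp add: words_def)
  qed
qed

lemma card_words_intertwine:
  assumes \<psi>: "\<psi> permutes {1..d}" and fg: "\<psi> \<circ> f = g \<circ> \<psi>"
  shows "card (words d f ({1..d} \<times> {1..d}) r) = card (words d g ({1..d} \<times> {1..d}) r)"
proof (rule antisym)
  have "inv' \<psi> \<circ> g = inv' \<psi> \<circ> (g \<circ> \<psi>) \<circ> inv' \<psi>"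
    by (simp add: fun_eq_iff permutes_inverses[OF \<psi>])
  also have "\<dots> = f \<circ> inv' \<psi>"
    unfolding fg[symmetric] by (simp add: fun_eq_iff permutes_inverses[OF \<psi>])
  finally show "card (words d g ({1..d} \<times> {1..d}) r) \<le> card (words d f ({1..d} \<times> {1..d}) r)"
    by (rule card_words_intertwine_le[OF permutes_inv[OF \<psi>]])
qed (rule card_words_intertwine_le[OF assms])

section \<open>From one permutation to its whole conjugacy class\<close>

text \<open>Orbit counting: sorting all \<open>\<psi>\<close> by the conjugate of
  \<open>\<sigma>\<close> they produce splits the symmetric group into fibres of the size given by
  \<open>card_intertwiners\<close>.\<close>

lemma card_cycle_type_class:
  assumes pos: "\<forall>k\<in>set \<mu>. 0 < k" and \<sigma>: "\<sigma> permutes {1..d}" "cycle_type d \<sigma> = mset \<mu>"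
  shows "card {\<rho>. \<rho> permutes {1..d} \<and> cycle_type d \<rho> = mset \<mu>} * (card (tuple_aut \<mu>) * prod_list \<mu>) = fact d"
proof -
  let ?Cl = "{\<rho>. \<rho> permutes {1..d} \<and> cycle_type d \<rho> = mset \<mu>}"
  let ?I = "\<lambda>\<rho>. {\<psi>. \<psi> permutes {1..d} \<and> \<psi> \<circ> \<sigma> = \<rho> \<circ> \<psi>}"
  have fin: "finite {\<psi>. \<psi> permutes {1..d}}"
    by (rule finite_permutations) simp
  have "{\<psi>. \<psi> permutes {1..d}} = (\<Union>\<rho>\<in>?Cl. ?I \<rho>)"
  proof (intro equalityI subsetI)
    fix \<psi> assume "\<psi> \<in> {\<psi>. \<psi> permutes {1..d}}"
    then have \<psi>: "\<psi> permutes {1..d}"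
      by simp
    define \<rho> where "\<rho> = \<psi> \<circ> \<sigma> \<circ> inv' \<psi>"
    have eq: "\<psi> \<circ> \<sigma> = \<rho> \<circ> \<psi>"
      by (simp add: \<rho>_def fun_eq_iff permutes_inverses[OF \<psi>])
    have "\<rho> permutes {1..d}"
      unfolding \<rho>_def by (rule permutes_compose[OF permutes_inv[OF \<psi>] permutes_compose[OF \<sigma>(1) \<psi>]])
    then show "\<psi> \<in> (\<Union>\<rho>\<in>?Cl. ?I \<rho>)"
      using \<psi> eq cycle_type_intertwine[OF \<psi> eq] \<sigma>(2) by auto
  qed auto
  moreover have "card (\<Union>\<rho>\<in>?Cl. ?I \<rho>) = (\<Sum>\<rho>\<in>?Cl. card (?I \<rho>))"
  proof (rule card_UN_disjoint)
    show "finite ?Cl" "\<forall>\<rho>\<in>?Cl. finite (?I \<rho>)"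
      using fin by (auto intro: rev_finite_subset)
    have cancel: "\<rho> = \<rho>'" if "\<psi> permutes {1..d}" "\<rho> \<circ> \<psi> = \<rho>' \<circ> \<psi>" for \<psi> \<rho> \<rho>' :: "nat \<Rightarrow> nat"
      using surj_fun_eq[OF permutes_surj[OF that(1)], of \<rho> \<rho>'] that(2) by (auto simp: fun_eq_iff)
    have "?I \<rho> \<inter> ?I \<rho>' = {}" if "\<rho> \<noteq> \<rho>'" for \<rho> \<rho>'
    proof (rule equals0I)
      fix \<psi> assume "\<psi> \<in> ?I \<rho> \<inter> ?I \<rho>'"
      then have \<psi>: "\<psi> permutes {1..d}" "\<psi> \<circ> \<sigma> = \<rho> \<circ> \<psi>" "\<psi> \<circ> \<sigma> = \<rho>' \<circ> \<psi>"
        by blast+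
      show False
        using cancel[OF \<psi>(1) trans[OF \<psi>(2)[symmetric] \<psi>(3)]] that by contradiction
    qed
    then show "\<forall>\<rho>\<in>?Cl. \<forall>\<rho>'\<in>?Cl. \<rho> \<noteq> \<rho>' \<longrightarrow> ?I \<rho> \<inter> ?I \<rho>' = {}"
      by simp
  qed
  moreover have "card (?I \<rho>) = card (tuple_aut \<mu>) * prod_list \<mu>" if "\<rho> \<in> ?Cl" for \<rho>
    using that \<sigma> by (intro card_intertwiners pos) (auto simp only: cycle_type_def finite_atLeastAtMost)
  ultimately have "card {\<psi>. \<psi> permutes {1..d}} = card ?Cl * (card (tuple_aut \<mu>) * prod_list \<mu>)"
    by (simp only: sum_constant of_nat_id cong: sum.cong)
  moreover have "card {\<psi>. \<psi> permutes {1..d}} = fact d"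
    by (rule card_permutations) simp_all
  ultimately show ?thesis
    by (simp only:)
qed

text \<open>Sort the tuples by their product. All products lie in one conjugacy class and have
  equally many factorizations, and the class size comes from
  \<open>card_cycle_type_class\<close>.\<close>

lemma card_hurwitz_tuples:
  assumes pos: "\<forall>k\<in>set \<mu>. 0 < k" and d: "d = sum_list \<mu>" and \<sigma>: "\<sigma> permutes {1..d}" "cycle_type d \<sigma> = mset \<mu>"
    and r: "int r = int d + 2 * g - 2 + int (length \<mu>)"
  shows "card (hurwitz_tuples g \<mu>) * (card (tuple_aut \<mu>) * prod_list \<mu>) =
    fact d * card (words d \<sigma> ({1..d} \<times> {1..d}) r)"
proof -
  let ?Cl = "{\<rho>. \<rho> permutes {1..d} \<and> cycle_type d \<rho> = mset \<mu>}" and ?R = "{1..d} \<times> {1..d}"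
  let ?a = "card (tuple_aut \<mu>) * prod_list \<mu>"
  have class_card: "card ?Cl * ?a = fact d"
    by (rule card_cycle_type_class[OF pos \<sigma>])
  have "hurwitz_tuples g \<mu> = (\<Union>\<rho>\<in>?Cl. words d \<rho> ?R r)"
  proof (intro equalityI subsetI)
    fix ts assume "ts \<in> hurwitz_tuples g \<mu>"
    then have ts: "int (length ts) = int r" "set ts \<subseteq> transpositions d"
      "transitive_on d (generate (sym_group d) (set ts))" "cycle_type d (foldr (\<circ>) ts id) = mset \<mu>"
      by (simp_all only: hurwitz_tuples_def mem_Collect_eq d r)
    have "foldr (\<circ>) ts id permutes {1..d}"
      using ts(2) transpositions_permutes by (intro foldr_comp_permutes) blast
    then have "foldr (\<circ>) ts id \<in> ?Cl"
      using ts(4) by blast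
    moreover have "ts \<in> words d (foldr (\<circ>) ts id) ?R r"
      using ts by (simp add: words_def transitive_on_iff_connectivity)
    ultimately show "ts \<in> (\<Union>\<rho>\<in>?Cl. words d \<rho> ?R r)"
      by blast
  next
    fix ts assume "ts \<in> (\<Union>\<rho>\<in>?Cl. words d \<rho> ?R r)"
    then obtain \<rho> where "ts \<in> words d \<rho> ?R r" "cycle_type d \<rho> = mset \<mu>"
      by blast
    then have "set ts \<subseteq> transpositions d" "length ts = r" "cycle_type d (foldr (\<circ>) ts id) = mset \<mu>"
      "transitive_on d (generate (sym_group d) (set ts))"
      by (auto simp only: words_def mem_Collect_eq transitive_on_iff_connectivity)
    then show "ts \<in> hurwitz_tuples g \<mu>"
      by (simp only: hurwitz_tuples_def mem_Collect_eq d[symmetric] r[symmetric])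
  qed
  moreover have "card (\<Union>\<rho>\<in>?Cl. words d \<rho> ?R r) = (\<Sum>\<rho>\<in>?Cl. card (words d \<rho> ?R r))"
  proof (rule card_UN_disjoint)
    show "finite ?Cl"
      using finite_permutations[of "{1..d}"] by (auto intro: rev_finite_subset)
    show "\<forall>\<rho>\<in>?Cl. finite (words d \<rho> ?R r)"
      using finite_words by blast
    show "\<forall>\<rho>\<in>?Cl. \<forall>\<rho>'\<in>?Cl. \<rho> \<noteq> \<rho>' \<longrightarrow> words d \<rho> ?R r \<inter> words d \<rho>' ?R r = {}"
      unfolding words_def by blast
  qed
  moreover have "card (words d \<rho> ?R r) = card (words d \<sigma> ?R r)" if "\<rho> \<in> ?Cl" for \<rho>
  proof -
    have "card {\<psi>. \<psi> permutes {1..d} \<and> \<psi> \<circ> \<sigma> = \<rho> \<circ> \<psi>} = ?a"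
      using that \<sigma> by (intro card_intertwiners pos) (auto simp only: cycle_type_def finite_atLeastAtMost)
    moreover have "?a \<noteq> 0"
      using class_card fact_nonzero[of d] by (metis mult_0_right)
    ultimately have "{\<psi>. \<psi> permutes {1..d} \<and> \<psi> \<circ> \<sigma> = \<rho> \<circ> \<psi>} \<noteq> {}"
      by (metis card.empty)
    then obtain \<psi> where \<psi>: "\<psi> permutes {1..d}" "\<psi> \<circ> \<sigma> = \<rho> \<circ> \<psi>"
      by blast
    show ?thesis
      by (rule card_words_intertwine[OF \<psi>, symmetric])
  qed
  ultimately have "card (hurwitz_tuples g \<mu>) = card ?Cl * card (words d \<sigma> ?R r)"
    by simp
  then have "card (hurwitz_tuples g \<mu>) * ?a = (card ?Cl * ?a) * card (words d \<sigma> ?R r)"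
    by (simp only: mult_ac)
  then show ?thesis
    unfolding class_card .
qed

theorem theorem1p5:
  fixes \<mu> :: "nat list" and d n :: nat
  assumes "\<forall>k\<in>set \<mu>. 0 < k"
    and "n = length \<mu>"
    and "d = sum_list \<mu>"
    and "2 \<le> d"
  shows "\<exists>C :: nat \<Rightarrow> int. \<forall>g :: nat.
    hurwitz_number (int g) \<mu> =
      2 / (fact d * real (prod_list \<mu>)) *
        (\<Sum>m = 1..d choose 2. real_of_int (C m) * real m ^ (d + 2 * g - 2 + n))"
proof (cases "\<exists>\<sigma>. \<sigma> permutes {1..d} \<and> cycle_type d \<sigma> = mset \<mu>")
  case True
  then obtain \<sigma> where \<sigma>: "\<sigma> permutes {1..d}" "cycle_type d \<sigma> = mset \<mu>"
    by blast
  let ?R = "{1..d} \<times> {1..d}"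
  have "equiv {1..d} ?R"
    by (auto simp: equiv_def refl_on_def sym_def trans_def)
  \<comment> \<open>The reference parity is \<open>d + n\<close>, since
    \<open>d + 2 * g - 2 + n\<close> has this parity for every \<open>g\<close>; hence one
    \<open>C\<close> serves all genera.\<close>
  then obtain C where C: "\<And>r. 0 < r \<Longrightarrow> even (r + (d + n)) \<Longrightarrow>
      fact d * int (card (words d \<sigma> ?R r)) = 2 * (\<Sum>m = 1..d choose 2. C m * int m ^ r)"
    using card_words_formula[OF \<sigma>(1), of ?R "d + n"] by blast
  \<comment> \<open>This makes the exponent positive even for \<open>d = 2\<close> and
    \<open>g = 0\<close>.\<close>
  have "n > 0"
    using assms by (cases \<mu>) auto
  have "hurwitz_number (int g) \<mu> = 2 / (fact d * real (prod_list \<mu>)) *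
        (\<Sum>m = 1..d choose 2. real_of_int (C m) * real m ^ (d + 2 * g - 2 + n))" for g
  proof -
    let ?r = "d + 2 * g - 2 + n"
    let ?N = "card (words d \<sigma> ?R ?r)" and ?T = "card (hurwitz_tuples (int g) \<mu>)"
    \<comment> \<open>The subtraction of \<open>2\<close> is exact because
      \<open>2 \<le> d\<close>.\<close>
    have r: "int ?r = int d + 2 * int g - 2 + int (length \<mu>)"
      using assms by (simp add: of_nat_diff)
    have "?r + (d + n) = 2 * (d + g + n - 1)"
      using assms(4) by simp
    then have "even (?r + (d + n))"
      by simp
    then have "real_of_int (fact d * int ?N) = real_of_int (2 * (\<Sum>m = 1..d choose 2. C m * int m ^ ?r))"
      using C[of ?r] \<open>n > 0\<close> by simp
    then have N: "fact d * real ?N = 2 * (\<Sum>m = 1..d choose 2. real_of_int (C m) * real m ^ ?r)"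
      by simp
    have "?T * (card (tuple_aut \<mu>) * prod_list \<mu>) = fact d * ?N"
      by (rule card_hurwitz_tuples[OF assms(1,3) \<sigma> r])
    then have "real (?T * (card (tuple_aut \<mu>) * prod_list \<mu>)) = real (fact d * ?N)"
      by (rule arg_cong)
    then have T: "real ?T * real (card (tuple_aut \<mu>)) * real (prod_list \<mu>) = fact d * real ?N"
      by (simp add: mult.assoc)
    have "prod_list \<mu> > 0"
      using assms(1) by (induction \<mu>) auto
    \<comment> \<open>Expanding the fraction by the product of the parts produces the left side of
      \<open>T\<close>; the factorial on its right side is then absorbed by
      \<open>N\<close>.\<close>
    then have "hurwitz_number (int g) \<mu> = real ?T * real (card (tuple_aut \<mu>)) * real (prod_list \<mu>) /
        (fact d * real (prod_list \<mu>))"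
      by (simp add: hurwitz_number_def assms(3))
    then show ?thesis
      unfolding T N by simp
  qed
  then show ?thesis
    by blast
next
  case False
  \<comment> \<open>Without a permutation of cycle type \<open>\<mu>\<close> there are no tuples and
    zero coefficients suffice. This case stands in for a construction of such a permutation.\<close>
  have "hurwitz_tuples (int g) \<mu> = {}" for g
  proof -
    have "foldr (\<circ>) ts id permutes {1..d}" if "set ts \<subseteq> transpositions d" for ts
      using that transpositions_permutes by (intro foldr_comp_permutes) blast
    then show ?thesis
      using False unfolding hurwitz_tuples_def assms(3)[symmetric] by blast
  qed
  then show ?thesis
    by (intro exI[of _ "\<lambda>_. 0"]) (simp add: hurwitz_number_def)
qed

end
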